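(* Let $A=(E/C,\gamma,a)$ be a cyclic algebra over $C$ of degree $d$. Let $\sigma$ be an automorphism of $A$ of finite order $n$ modulo inner automorphisms such that $\sigma|_C$ has order $n$, let $F=C\cap{\rm Fix}(\sigma)$, and let $u\in A^\times$ satisfy $\sigma^n(z)=uzu^{-1}$ for all $z\in A$ and $\sigma(u)=u$. Suppose that $\sigma|_E\in{\rm Aut}(E)$, $u\in E$, and $\gamma\circ\sigma=\sigma\circ\gamma$. Put $R=A[t;\sigma]$ and $x=u^{-1}t^n$, and let $N$ be the reduced norm of the central simple $F(x)$-algebra $A(t;\sigma)$. Let $f\in R$ be a monic polynomial of degree $m$ such that $(f,t)_r=1$, let $h(t)=\hat h(u^{-1}t^n)$ with $\hat h\in F[x]$ monic be its minimal central left multiple, and suppose that $\deg(\hat h)=dm$ (degree in $x$). (i) If $N(f)=\hat h_1\cdots\hat h_l$ such that $\hat h_i\in F[x]$ is irreducible for $1\le i\le l$, then there exists a decomposition $f=f_1\cdots f_l$ of $f$ into irreducible factors $f_i$ such that $N(f_i)=\hat h_i$ for all $i$, $1\le i\le l$. Moreover, $\deg(f_i)=\deg(N(f_i))/d$, where $\deg(f_i)$ is the degree in $t$ and $\deg(N(f_i))$ the degree in $x$. (ii) Assume that $N(f)$ is the product of $l$ distinct irreducible factors $\hat h_1,\dots,\hat h_l$ in $F[x]$. Then $f$ has exactly $l!$ factorizations into irreducible factors, corresponding to each possible ordering of the factors of $N(f)$.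
   Context: The cyclic algebra $(E/C,\gamma,a)$, with $E/C$ cyclic Galois of degree $d$, ${\rm Gal}(E/C)=\langle\gamma\rangle$, $a\in C^\times$, is $\bigoplus_{i=0}^{d-1}Ee^i$ with $e^d=a$ and $ez=\gamma(z)e$ for $z\in E$. $A[t;\sigma]$ is the skew polynomial ring with $tb=\sigma(b)t$ for $b\in A$; its center is $C(R)=F[x]$, $x=u^{-1}t^n$. The ring of central quotients $A(t;\sigma)=\{f/g : f\in R,\ 0\ne g\in F[x]\}$ is a central simple algebra of degree $dn$ over $F(x)$, $N$ is its reduced norm, and $N(f)\in F[x]$ for $f\in R$. ${\rm Fix}(\sigma)=\{b\in A:\sigma(b)=b\}$. An element $f$ of $R$ is irreducible if it is not a unit and is not a product $gq$ with $g,q\in R$ and $1\le\deg g,\deg q<\deg f$. $(f,t)_r$ is the greatest common right divisor of $f$ and $t$. The minimal central left multiple of $f$ is the unique polynomial $h\in C(R)$ of minimal degree such that $h=gf$ for some $g\in R$ and $h(t)=\hat h(u^{-1}t^n)$ with $\hat h\in F[x]$ monic.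
   Formalization: A is assumed to be a division algebra (false for split A); N(f_i) equals the i-th given irreducible factor only up to nonzero constants of F with product 1 (literal equality can fail); factorizations are counted with monic factors, and "distinct" means non-associated. *)

theory Defs
  imports
    "HOL-Algebra.Algebraic_Closure_Type"
    "HOL-Computational_Algebra.Computational_Algebra"
    "Jordan_Normal_Form.Determinant"
begin

section \<open>Subfields of a division ring, bases, Galois extensions\<close>

definition is_subfield :: "'a::division_ring set \<Rightarrow> bool" where
  "is_subfield K \<longleftrightarrow> 1 \<in> K \<and>
     (\<forall>x\<in>K. \<forall>y\<in>K. x - y \<in> K \<and> x * y \<in> K \<and> x * y = y * x) \<and> (\<forall>x\<in>K. inverse x \<in> K)"

definition ring_aut_on :: "'a::ring_1 set \<Rightarrow> ('a \<Rightarrow> 'a) \<Rightarrow> bool" where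
  "ring_aut_on S \<tau> \<longleftrightarrow> bij_betw \<tau> S S \<and> \<tau> 1 = 1 \<and>
     (\<forall>x\<in>S. \<forall>y\<in>S. \<tau> (x + y) = \<tau> x + \<tau> y \<and> \<tau> (x * y) = \<tau> x * \<tau> y)"

text \<open>\<open>b 0, \<dots>, b (r - 1)\<close> is a basis of the left \<open>K\<close>-vector space \<open>V\<close>.\<close>

definition is_basis :: "'a::ring_1 set \<Rightarrow> 'a set \<Rightarrow> nat \<Rightarrow> (nat \<Rightarrow> 'a) \<Rightarrow> bool" where
  "is_basis K V r b \<longleftrightarrow> (\<forall>i<r. b i \<in> V) \<and>
     (\<forall>v\<in>V. \<exists>!c. (\<forall>i<r. c i \<in> K) \<and> (\<forall>i\<ge>r. c i = 0) \<and> v = (\<Sum>i<r. c i * b i))"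

text \<open>Only the values of the automorphisms on \<open>E\<close> matter, so elements of the Galois group are
  compared pointwise on \<open>E\<close>.\<close>

definition galois_group :: "'a::division_ring set \<Rightarrow> 'a set \<Rightarrow> ('a \<Rightarrow> 'a) set" where
  "galois_group E C = {\<tau>. ring_aut_on E \<tau> \<and> (\<forall>c\<in>C. \<tau> c = c)}"

definition cyclic_galois ::
  "'a::division_ring set \<Rightarrow> 'a set \<Rightarrow> ('a \<Rightarrow> 'a) \<Rightarrow> nat \<Rightarrow> bool" where
  "cyclic_galois E C \<gamma> d \<longleftrightarrow> is_subfield C \<and> is_subfield E \<and> C \<subseteq> E \<and>
     (\<exists>b. is_basis C E d b) \<and>
     {z\<in>E. \<forall>\<tau>\<in>galois_group E C. \<tau> z = z} = C \<and>
     \<gamma> \<in> galois_group E C \<and>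
     (\<forall>\<tau>\<in>galois_group E C. \<exists>k. \<forall>z\<in>E. \<tau> z = (\<gamma> ^^ k) z)"

text \<open>The whole type is the cyclic algebra \<open>(E/C, \<gamma>, a)\<close>, that is \<open>E \<oplus> Ee \<oplus> \<dots> \<oplus> Ee\<^sup>d\<^sup>-\<^sup>1\<close>
  with \<open>e\<^sup>d = a\<close>. The type class requires it to be a division algebra. Over the split algebra
  \<open>M\<^sub>2(C)\<close> with \<open>\<sigma> = id\<close> and \<open>u = 1\<close>, the degree formula fails: \<open>t - diag(1, 2)\<close> has the norm
  \<open>(x - 1)(x - 2)\<close>, so it would need factors of degree \<open>1/2\<close> in \<open>t\<close>.\<close>

definition cyclic_algebra ::
  "'a::division_ring set \<Rightarrow> 'a set \<Rightarrow> ('a \<Rightarrow> 'a) \<Rightarrow> nat \<Rightarrow> 'a \<Rightarrow> 'a \<Rightarrow> bool" where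
  "cyclic_algebra E C \<gamma> d a e \<longleftrightarrow> cyclic_galois E C \<gamma> d \<and> a \<in> C \<and> a \<noteq> 0 \<and>
     is_basis E UNIV d (\<lambda>i. e ^ i) \<and> e ^ d = a \<and> (\<forall>z\<in>E. e * z = \<gamma> z * e)"

definition is_inner :: "('a::division_ring \<Rightarrow> 'a) \<Rightarrow> bool" where
  "is_inner \<tau> \<longleftrightarrow> (\<exists>v. v \<noteq> 0 \<and> (\<forall>z. \<tau> z = v * z * inverse v))"

definition has_order_mod_inner :: "('a::division_ring \<Rightarrow> 'a) \<Rightarrow> nat \<Rightarrow> bool" where
  "has_order_mod_inner \<tau> n \<longleftrightarrow>
     0 < n \<and> is_inner (\<tau> ^^ n) \<and> (\<forall>k. 0 < k \<and> k < n \<longrightarrow> \<not> is_inner (\<tau> ^^ k))"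

definition has_order_on :: "'a set \<Rightarrow> ('a \<Rightarrow> 'a) \<Rightarrow> nat \<Rightarrow> bool" where
  "has_order_on S \<tau> n \<longleftrightarrow> 0 < n \<and> (\<forall>c\<in>S. (\<tau> ^^ n) c = c) \<and>
     (\<forall>k. 0 < k \<and> k < n \<longrightarrow> (\<exists>c\<in>S. (\<tau> ^^ k) c \<noteq> c))"

section \<open>The skew polynomial ring\<close>

text \<open>The elements of \<open>A[t;\<sigma>]\<close> are the elements \<open>\<Sum> b\<^sub>i t\<^sup>i\<close> of the type \<open>'a poly\<close> (coefficients on
  the left), with the usual addition and degree, and with the multiplication determined by
  \<open>t b = \<sigma>(b) t\<close>. The multiplication of the type \<open>'a poly\<close> is not available for noncommutative
  coefficients. The unit element is \<open>[:1:]\<close>.\<close>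

definition skew_mult :: "('a::ring_1 \<Rightarrow> 'a) \<Rightarrow> 'a poly \<Rightarrow> 'a poly \<Rightarrow> 'a poly" where
  "skew_mult \<sigma> f g = (\<Sum>i\<le>Polynomial.degree f. \<Sum>k\<le>Polynomial.degree g.
     Polynomial.monom (Polynomial.coeff f i * (\<sigma> ^^ i) (Polynomial.coeff g k)) (i + k))"

definition skew_prod :: "('a::ring_1 \<Rightarrow> 'a) \<Rightarrow> 'a poly list \<Rightarrow> 'a poly" where
  "skew_prod \<sigma> fs = foldr (skew_mult \<sigma>) fs [:1:]"

definition skew_power :: "('a::ring_1 \<Rightarrow> 'a) \<Rightarrow> 'a poly \<Rightarrow> nat \<Rightarrow> 'a poly" where
  "skew_power \<sigma> f k = skew_prod \<sigma> (replicate k f)"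

definition skew_unit :: "('a::ring_1 \<Rightarrow> 'a) \<Rightarrow> 'a poly \<Rightarrow> bool" where
  "skew_unit \<sigma> f \<longleftrightarrow> (\<exists>g. skew_mult \<sigma> f g = [:1:] \<and> skew_mult \<sigma> g f = [:1:])"

definition skew_irreducible :: "('a::ring_1 \<Rightarrow> 'a) \<Rightarrow> 'a poly \<Rightarrow> bool" where
  "skew_irreducible \<sigma> f \<longleftrightarrow> \<not> skew_unit \<sigma> f \<and>
     \<not> (\<exists>g q. f = skew_mult \<sigma> g q \<and>
            1 \<le> Polynomial.degree g \<and> Polynomial.degree g < Polynomial.degree f \<and>
            1 \<le> Polynomial.degree q \<and> Polynomial.degree q < Polynomial.degree f)"

definition right_divides :: "('a::ring_1 \<Rightarrow> 'a) \<Rightarrow> 'a poly \<Rightarrow> 'a poly \<Rightarrow> bool" where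
  "right_divides \<sigma> f h \<longleftrightarrow> (\<exists>g. h = skew_mult \<sigma> g f)"

definition is_gcrd :: "('a::ring_1 \<Rightarrow> 'a) \<Rightarrow> 'a poly \<Rightarrow> 'a poly \<Rightarrow> 'a poly \<Rightarrow> bool" where
  "is_gcrd \<sigma> f g h \<longleftrightarrow> right_divides \<sigma> h f \<and> right_divides \<sigma> h g \<and>
     (\<forall>q. right_divides \<sigma> q f \<and> right_divides \<sigma> q g \<longrightarrow> right_divides \<sigma> q h)"

definition skew_center :: "('a::ring_1 \<Rightarrow> 'a) \<Rightarrow> 'a poly set" where
  "skew_center \<sigma> = {z. \<forall>g. skew_mult \<sigma> z g = skew_mult \<sigma> g z}"

text \<open>The field \<open>F\<close> is represented by a type \<open>'k\<close> with an embedding \<open>\<iota>\<close> into \<open>A\<close>, so that \<open>F[x]\<close> and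
  \<open>F(x)\<close> are the types \<open>'k poly\<close> and \<open>'k poly fract\<close>. For \<open>p \<in> F[x]\<close>, the following is
  \<open>p(u\<^sup>-\<^sup>1t\<^sup>n) \<in> A[t;\<sigma>]\<close>.\<close>

definition at_x ::
  "('a::division_ring \<Rightarrow> 'a) \<Rightarrow> 'a \<Rightarrow> nat \<Rightarrow> ('k::field \<Rightarrow> 'a) \<Rightarrow> 'k poly \<Rightarrow> 'a poly" where
  "at_x \<sigma> u n \<iota> p = (\<Sum>k\<le>Polynomial.degree p.
     skew_mult \<sigma> [:\<iota> (Polynomial.coeff p k):]
       (skew_power \<sigma> (Polynomial.monom (inverse u) n) k))"

text \<open>\<open>h = ph(u\<^sup>-\<^sup>1t\<^sup>n)\<close> is the minimal central left multiple of \<open>f\<close>.\<close>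

definition is_min_central_left_multiple ::
  "('a::division_ring \<Rightarrow> 'a) \<Rightarrow> 'a \<Rightarrow> nat \<Rightarrow> ('k::field \<Rightarrow> 'a) \<Rightarrow> 'a poly \<Rightarrow> 'a poly \<Rightarrow> 'k poly \<Rightarrow> bool"
  where
  "is_min_central_left_multiple \<sigma> u n \<iota> f h ph \<longleftrightarrow>
     h = at_x \<sigma> u n \<iota> ph \<and> Polynomial.lead_coeff ph = 1 \<and>
     h \<in> skew_center \<sigma> \<and> right_divides \<sigma> f h \<and>
     (\<forall>p. Polynomial.lead_coeff p = 1 \<and> at_x \<sigma> u n \<iota> p \<in> skew_center \<sigma> \<and>
          right_divides \<sigma> f (at_x \<sigma> u n \<iota> p) \<longrightarrow>
          Polynomial.degree h \<le> Polynomial.degree (at_x \<sigma> u n \<iota> p))"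

section \<open>The ring of central quotients and its reduced norm\<close>

text \<open>The type \<open>'b\<close> is the ring of central quotients \<open>A(t;\<sigma>)\<close>, with \<open>j\<close> the inclusion of \<open>A[t;\<sigma>]\<close>
  and \<open>\<kappa>\<close> the inclusion of \<open>F(x)\<close>; since \<open>\<kappa>\<close> is a homomorphism on a field, every \<open>g(x) \<noteq> 0\<close> is
  invertible in \<open>'b\<close>. The last conjunct says that all elements have the form \<open>f/g\<close>. These properties
  determine \<open>'b\<close> up to a unique isomorphism.\<close>

definition is_central_quotient_ring ::
  "('a::division_ring \<Rightarrow> 'a) \<Rightarrow> 'a \<Rightarrow> nat \<Rightarrow> ('k::field \<Rightarrow> 'a) \<Rightarrow>
   ('a poly \<Rightarrow> 'b::ring_1) \<Rightarrow> ('k poly fract \<Rightarrow> 'b) \<Rightarrow> bool" where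
  "is_central_quotient_ring \<sigma> u n \<iota> j \<kappa> \<longleftrightarrow>
     inj j \<and> j [:1:] = 1 \<and>
     (\<forall>f g. j (f + g) = j f + j g \<and> j (skew_mult \<sigma> f g) = j f * j g) \<and>
     Ring_Hom.ring_hom \<kappa> \<and>
     (\<forall>p. \<kappa> (to_fract p) = j (at_x \<sigma> u n \<iota> p)) \<and>
     (\<forall>b. \<exists>f g. g \<noteq> 0 \<and> b = j f * \<kappa> (inverse (to_fract g)))"

text \<open>Let \<open>B\<close> be an algebra over the field \<open>K\<close> with structure map \<open>\<kappa> : K \<rightarrow> B\<close>, and let \<open>L\<close> be the
  algebraic closure of \<open>K\<close>. The map \<open>\<phi>\<close> is a homomorphism of \<open>K\<close>-algebras from \<open>B\<close> to the matrix
  ring \<open>M\<^sub>r(L)\<close> whose \<open>L\<close>-linear extension is an isomorphism from \<open>B \<otimes>\<^sub>K L\<close> to \<open>M\<^sub>r(L)\<close>: some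
  \<open>K\<close>-basis of \<open>B\<close> with \<open>r\<^sup>2\<close> elements is mapped to a spanning set of \<open>M\<^sub>r(L)\<close>.
  Such a \<open>\<phi>\<close> exists if and only if \<open>B\<close> is central simple of degree \<open>r\<close> over \<open>K\<close>.\<close>

definition is_splitting ::
  "('K::field \<Rightarrow> 'b::ring_1) \<Rightarrow> nat \<Rightarrow> ('b \<Rightarrow> 'K alg_closure mat) \<Rightarrow> bool" where
  "is_splitting \<kappa> r \<phi> \<longleftrightarrow>
     (\<forall>b. \<phi> b \<in> carrier_mat r r) \<and>
     (\<forall>b c. \<phi> (b + c) = \<phi> b + \<phi> c \<and> \<phi> (b * c) = \<phi> b * \<phi> c) \<and>
     (\<forall>k. \<phi> (\<kappa> k) = to_ac k \<cdot>\<^sub>m 1\<^sub>m r) \<and>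
     (\<exists>\<beta>. is_basis (range \<kappa>) UNIV (r\<^sup>2) \<beta> \<and>
        (\<forall>M\<in>carrier_mat r r. \<exists>c. \<forall>i<r. \<forall>l<r. M $$ (i, l) = (\<Sum>q<r\<^sup>2. c q * \<phi> (\<beta> q) $$ (i, l))))"

text \<open>The reduced norm of a central simple \<open>K\<close>-algebra of degree \<open>r\<close>; by the Skolem--Noether theorem,
  it does not depend on the choice of \<open>\<phi>\<close>.\<close>

definition is_reduced_norm ::
  "('K::field \<Rightarrow> 'b::ring_1) \<Rightarrow> nat \<Rightarrow> ('b \<Rightarrow> 'K) \<Rightarrow> bool" where
  "is_reduced_norm \<kappa> r N \<longleftrightarrow>
     (\<exists>\<phi>. is_splitting \<kappa> r \<phi> \<and> (\<forall>b. to_ac (N b) = Determinant.det (\<phi> b)))"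

section \<open>Factorizations\<close>

text \<open>A factorization gives further ones by inserting \<open>c c\<^sup>-\<^sup>1\<close>, with a unit \<open>c\<close>, between two
  factors. Over a division ring, each class of factorizations of a monic polynomial modulo this
  operation contains exactly one with monic factors.\<close>

definition factorizations :: "('a::ring_1 \<Rightarrow> 'a) \<Rightarrow> 'a poly \<Rightarrow> 'a poly list set" where
  "factorizations \<sigma> f = {fs. f = skew_prod \<sigma> fs \<and>
     (\<forall>g\<in>set fs. skew_irreducible \<sigma> g \<and> Polynomial.lead_coeff g = 1)}"

text \<open>Equality of the norms \<open>\<nu> g\<close> of the elements of \<open>fs\<close> with the elements of \<open>hs\<close>, in this order
  and up to nonzero constants whose product is 1. The constants cannot be avoided: in \<open>\<complex>[t; \<sigma>]\<close> with
  \<open>\<sigma>\<close> the complex conjugation and \<open>x = t\<^sup>2\<close>, the polynomial \<open>(t - 1)(t - (1 + i))\<close> has the norm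
  \<open>(x - 1)(x - 2)\<close>, but any polynomial of degree 1 has a norm with negative leading coefficient.\<close>

definition norms_match ::
  "('r \<Rightarrow> 'k::field poly fract) \<Rightarrow> 'r list \<Rightarrow> 'k poly list \<Rightarrow> bool" where
  "norms_match \<nu> fs hs \<longleftrightarrow> length fs = length hs \<and>
     (\<exists>c. (\<Prod>i<length hs. c i) = 1 \<and>
          (\<forall>i<length hs. \<nu> (fs ! i) = to_fract (Polynomial.smult (c i) (hs ! i))))"

end

theory Submission
  imports Defs "HOL-Combinatorics.Multiset_Permutations"
begin

text \<open>For \<open>0 \<noteq> g \<in> A[t;\<sigma>]\<close>, the norm \<open>\<nu> g \<in> F[x]\<close> has the degree \<open>d \<cdot> deg g\<close>: left multiplication
  by \<open>g\<close> on the free \<open>F[x]\<close>-module \<open>A[t;\<sigma>]\<close> of rank \<open>(dn)\<^sup>2\<close> has the determinant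
  \<open>(\<nu> g)\<^sup>d\<^sup>n\<close>, a Leibniz expansion bounds its degree from above, and multiplicativity of the norm on
  \<open>g y = p(x)\<close> turns the bound into an equality. If an irreducible \<open>\<pi>\<close> divides \<open>\<nu> g\<close>, then \<open>g\<close> and
  \<open>\<pi>(x)\<close> have a nontrivial common right divisor; hence \<open>g\<close> divides its norm, and the minimal central
  left multiple has at most the degree of the norm. The hypothesis on \<open>f\<close> says that the two agree up
  to a constant. This is inherited by all factors, and then for every irreducible \<open>\<pi>\<close> dividing
  \<open>\<nu> f\<close> the greatest common right divisor of \<open>f\<close> and \<open>\<pi>(x)\<close> is the only monic right factor
  with the norm \<open>\<pi>\<close> up to a constant. So \<open>f\<close> can be split off uniquely from the right in any
  prescribed order of the norms.\<close>

section \<open>Skew polynomials over a division ring\<close>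

text \<open>The reduced norm is a determinant over the algebraic closure of F(x), where neither
  polynomiality nor a degree in x is visible. The determinant of left multiplication on a free
  F[x]-module shows both, but it is only the \<open>r\<close>-th power of the norm, with
  \<open>r = d * n\<close>. As F[x] is integrally closed, the norm itself is a polynomial, and the
  degree bound is divided by \<open>r\<close>. A term p(x) a t^i has degree n deg(p) + i in t;
  carrying i as a weight of the basis element makes the Leibniz bound sharp. The rank of the module
  comes from the splitting: an F(x)-basis of the quotient ring with \<open>r^2\<close> elements
  forces an F-basis of A to be finite. Norms of monic polynomials need not be monic, so norms are
  compared by \<open>proportional\<close> until the very end, where the constants multiply to 1
  automatically. The factorization argument uses only formal properties of the norm, which are
  collected in \<open>skew_norm\<close>.\<close>

locale skew_poly =
  fixes \<sigma> :: "'a::division_ring \<Rightarrow> 'a"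
  assumes aut: "ring_aut_on UNIV \<sigma>"
begin

abbreviation mult :: "'a poly \<Rightarrow> 'a poly \<Rightarrow> 'a poly" (infixl \<open>\<star>\<close> 70) where
  "f \<star> g \<equiv> skew_mult \<sigma> f g"

lemma aut_1: "\<sigma> 1 = 1" and aut_add: "\<sigma> (x + y) = \<sigma> x + \<sigma> y" and aut_mult: "\<sigma> (x * y) = \<sigma> x * \<sigma> y"
  and aut_bij: "bij \<sigma>"
  using aut by (auto simp: ring_aut_on_def)

lemma aut_0: "\<sigma> 0 = 0"
  using aut_add[of 0 0] by simp

lemma aut_eq_0_iff: "\<sigma> x = 0 \<longleftrightarrow> x = 0"
  using aut_bij aut_0 by (metis bij_pointE)

lemma aut_pow_1 [simp]: "(\<sigma> ^^ i) 1 = 1"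
  by (induction i) (simp_all add: aut_1)

lemma aut_pow_0 [simp]: "(\<sigma> ^^ i) 0 = 0"
  by (induction i) (simp_all add: aut_0)

lemma aut_pow_add: "(\<sigma> ^^ i) (x + y) = (\<sigma> ^^ i) x + (\<sigma> ^^ i) y"
  by (induction i) (simp_all add: aut_add)

lemma aut_pow_mult: "(\<sigma> ^^ i) (x * y) = (\<sigma> ^^ i) x * (\<sigma> ^^ i) y"
  by (induction i) (simp_all add: aut_mult)

lemma aut_pow_eq_0_iff [simp]: "(\<sigma> ^^ i) x = 0 \<longleftrightarrow> x = 0"
  by (induction i) (simp_all add: aut_eq_0_iff)

lemma aut_pow_fixed: "\<sigma> x = x \<Longrightarrow> (\<sigma> ^^ i) x = x"
  by (induction i) simp_all

text \<open>The definition sums up to the degrees, which addition does not respect. The convolution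
  formula is free of degrees, so that distributivity and products with monomials can be checked
  coefficientwise.\<close>

lemma coeff_skew_mult:
  "Polynomial.coeff (f \<star> g) l =
     (\<Sum>i\<le>l. Polynomial.coeff f i * (\<sigma> ^^ i) (Polynomial.coeff g (l - i)))"
proof -
  have inner: "(\<Sum>k\<le>Polynomial.degree g.
        if i + k = l then Polynomial.coeff f i * (\<sigma> ^^ i) (Polynomial.coeff g k) else 0) =
      (if i \<le> l then Polynomial.coeff f i * (\<sigma> ^^ i) (Polynomial.coeff g (l - i)) else 0)" for i
  proof (cases "i \<le> l")
    case True
    have "(\<Sum>k\<le>Polynomial.degree g.
        if i + k = l then Polynomial.coeff f i * (\<sigma> ^^ i) (Polynomial.coeff g k) else 0) =
      (\<Sum>k\<le>Polynomial.degree g.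
        if k = l - i then Polynomial.coeff f i * (\<sigma> ^^ i) (Polynomial.coeff g k) else 0)"
      using True by (intro sum.cong) auto
    also have "\<dots> = Polynomial.coeff f i * (\<sigma> ^^ i) (Polynomial.coeff g (l - i))"
      by (simp add: sum.delta coeff_eq_0)
    finally show ?thesis using True by simp
  qed (auto intro!: sum.neutral)
  have "Polynomial.coeff (f \<star> g) l = (\<Sum>i\<le>Polynomial.degree f.
      if i \<le> l then Polynomial.coeff f i * (\<sigma> ^^ i) (Polynomial.coeff g (l - i)) else 0)"
    by (simp add: skew_mult_def Polynomial.coeff_sum inner[symmetric] cong: if_cong)
  also have "\<dots> = (\<Sum>i\<in>{..Polynomial.degree f} \<inter> {..l}.
      Polynomial.coeff f i * (\<sigma> ^^ i) (Polynomial.coeff g (l - i)))"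
    by (subst sum.inter_restrict) auto
  also have "\<dots> = (\<Sum>i\<le>l. Polynomial.coeff f i * (\<sigma> ^^ i) (Polynomial.coeff g (l - i)))"
    by (intro sum.mono_neutral_left) (auto simp: coeff_eq_0)
  finally show ?thesis .
qed

lemma mult_add_left: "(f + f') \<star> g = f \<star> g + f' \<star> g"
  by (simp add: poly_eq_iff coeff_skew_mult distrib_right sum.distrib)

lemma mult_add_right: "f \<star> (g + g') = f \<star> g + f \<star> g'"
  by (simp add: poly_eq_iff coeff_skew_mult aut_pow_add distrib_left sum.distrib)

lemma mult_0_left [simp]: "0 \<star> g = 0"
  by (simp add: poly_eq_iff coeff_skew_mult)

lemma mult_0_right [simp]: "f \<star> 0 = 0"
  by (simp add: poly_eq_iff coeff_skew_mult)

lemma mult_minus_left: "(- f) \<star> g = - (f \<star> g)"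
  by (simp add: poly_eq_iff coeff_skew_mult sum_negf)

lemma mult_minus_right: "f \<star> (- g) = - (f \<star> g)"
  using mult_add_right[of f g "- g"] by (simp add: eq_neg_iff_add_eq_0 add.commute)

lemma mult_diff_left: "(f - f') \<star> g = f \<star> g - f' \<star> g"
  using mult_add_left[of f "- f'" g] by (simp add: mult_minus_left)

lemma mult_diff_right: "f \<star> (g - g') = f \<star> g - f \<star> g'"
  using mult_add_right[of f g "- g'"] by (simp add: mult_minus_right)

lemma mult_sum_left: "sum h S \<star> g = (\<Sum>x\<in>S. h x \<star> g)"
  by (induction S rule: infinite_finite_induct) (simp_all add: mult_add_left)

lemma mult_sum_right: "f \<star> sum h S = (\<Sum>x\<in>S. f \<star> h x)"
  by (induction S rule: infinite_finite_induct) (simp_all add: mult_add_right)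

lemma coeff_monom_mult:
  "Polynomial.coeff (Polynomial.monom a i \<star> g) l =
     (if i \<le> l then a * (\<sigma> ^^ i) (Polynomial.coeff g (l - i)) else 0)"
proof -
  have "Polynomial.coeff (Polynomial.monom a i \<star> g) l =
      (\<Sum>i'\<le>l. if i' = i then a * (\<sigma> ^^ i) (Polynomial.coeff g (l - i)) else 0)"
    unfolding coeff_skew_mult by (intro sum.cong) auto
  then show ?thesis by simp
qed

lemma coeff_mult_monom:
  "Polynomial.coeff (g \<star> Polynomial.monom a i) l =
     (if i \<le> l then Polynomial.coeff g (l - i) * (\<sigma> ^^ (l - i)) a else 0)"
proof (cases "i \<le> l")
  case True
  have "Polynomial.coeff (g \<star> Polynomial.monom a i) l =
      (\<Sum>k\<le>l. if k = l - i then Polynomial.coeff g (l - i) * (\<sigma> ^^ (l - i)) a else 0)"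
    unfolding coeff_skew_mult using True by (intro sum.cong) (auto simp: eq_diff_iff)
  then show ?thesis using True by simp
qed (auto simp: coeff_skew_mult intro!: sum.neutral)

lemma monom_mult_monom:
  "Polynomial.monom a i \<star> Polynomial.monom b k = Polynomial.monom (a * (\<sigma> ^^ i) b) (i + k)"
  by (auto simp: poly_eq_iff coeff_monom_mult)

lemma monom_mult_assoc:
  "Polynomial.monom a i \<star> Polynomial.monom b k \<star> g = Polynomial.monom a i \<star> (Polynomial.monom b k \<star> g)"
  by (auto simp: poly_eq_iff monom_mult_monom coeff_monom_mult aut_pow_mult funpow_add mult.assoc)

text \<open>By distributivity, the first two factors may be taken to be monomials. There the claim
  is that \<sigma>^i is multiplicative and that \<sigma>^i after \<sigma>^k is
  \<sigma>^(i+k).\<close>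

lemma mult_assoc: "f \<star> g \<star> h = f \<star> (g \<star> h)"
proof -
  \<comment> \<open>The coefficients \<open>b\<close> and the bound \<open>m\<close> are arbitrary,
    because rewriting \<open>g\<close> itself as a sum of monomials would also rewrite the
    \<open>g\<close> inside that sum.\<close>
  have "Polynomial.monom a i \<star> (\<Sum>k\<le>m. Polynomial.monom (b k) k) \<star> h =
      Polynomial.monom a i \<star> ((\<Sum>k\<le>m. Polynomial.monom (b k) k) \<star> h)" for a i m b
    by (simp add: mult_sum_left mult_sum_right monom_mult_assoc)
  from this[of _ _ "Polynomial.coeff g" "Polynomial.degree g"]
  have monom: "Polynomial.monom a i \<star> g \<star> h = Polynomial.monom a i \<star> (g \<star> h)" for a i
    by (simp add: poly_as_sum_of_monoms)
  have "(\<Sum>k\<le>m. Polynomial.monom (b k) k) \<star> g \<star> h =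
      (\<Sum>k\<le>m. Polynomial.monom (b k) k) \<star> (g \<star> h)" for b m
    by (simp add: mult_sum_left monom)
  from this[of "Polynomial.coeff f" "Polynomial.degree f"] show ?thesis
    by (simp add: poly_as_sum_of_monoms)
qed

lemma coeff_const_mult: "Polynomial.coeff ([:c:] \<star> g) l = c * Polynomial.coeff g l"
  by (simp add: coeff_monom_mult flip: monom_0)

lemma one_mult [simp]: "[:1:] \<star> g = g"
  by (simp add: poly_eq_iff coeff_const_mult)

lemma mult_one [simp]: "g \<star> [:1:] = g"
  by (simp add: poly_eq_iff coeff_mult_monom flip: monom_0)

lemma coeff_mult_degree_sum:
  "Polynomial.coeff (f \<star> g) (Polynomial.degree f + Polynomial.degree g) =
     Polynomial.lead_coeff f * (\<sigma> ^^ Polynomial.degree f) (Polynomial.lead_coeff g)"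
proof -
  have "Polynomial.coeff (f \<star> g) (Polynomial.degree f + Polynomial.degree g) =
    (\<Sum>i\<le>Polynomial.degree f + Polynomial.degree g.
      if i = Polynomial.degree f
      then Polynomial.lead_coeff f * (\<sigma> ^^ Polynomial.degree f) (Polynomial.lead_coeff g) else 0)"
    unfolding coeff_skew_mult
  proof (intro sum.cong refl, goal_cases)
    case (1 i)
    then show ?case
      by (cases i "Polynomial.degree f" rule: linorder_cases) (auto simp: coeff_eq_0)
  qed
  then show ?thesis by simp
qed

lemma degree_mult_le: "Polynomial.degree (f \<star> g) \<le> Polynomial.degree f + Polynomial.degree g"
proof (rule degree_le, intro allI impI)
  fix l assume "Polynomial.degree f + Polynomial.degree g < l"
  then have "Polynomial.degree f < i \<or> Polynomial.degree g < l - i" if "i \<le> l" for i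
    using that by linarith
  then show "Polynomial.coeff (f \<star> g) l = 0"
    unfolding coeff_skew_mult by (intro sum.neutral) (force simp: coeff_eq_0)
qed

lemma degree_mult:
  assumes "f \<noteq> 0" "g \<noteq> 0"
  shows "Polynomial.degree (f \<star> g) = Polynomial.degree f + Polynomial.degree g"
proof (rule antisym[OF degree_mult_le])
  have "Polynomial.coeff (f \<star> g) (Polynomial.degree f + Polynomial.degree g) \<noteq> 0"
    using assms by (simp add: coeff_mult_degree_sum)
  then show "Polynomial.degree f + Polynomial.degree g \<le> Polynomial.degree (f \<star> g)"
    by (rule Polynomial.le_degree)
qed

lemma mult_eq_0_iff: "f \<star> g = 0 \<longleftrightarrow> f = 0 \<or> g = 0"
  using coeff_mult_degree_sum[of f g] by auto

lemma lead_coeff_mult: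
  "Polynomial.lead_coeff (f \<star> g) =
     Polynomial.lead_coeff f * (\<sigma> ^^ Polynomial.degree f) (Polynomial.lead_coeff g)"
  by (cases "f = 0 \<or> g = 0") (auto simp: degree_mult coeff_mult_degree_sum)

lemma mult_right_cancel: "f \<star> g = f' \<star> g \<Longrightarrow> g \<noteq> 0 \<Longrightarrow> f = f'"
  using mult_eq_0_iff[of "f - f'" g] by (simp add: mult_diff_left)

lemma mult_left_cancel: "f \<star> g = f \<star> g' \<Longrightarrow> f \<noteq> 0 \<Longrightarrow> g = g'"
  using mult_eq_0_iff[of f "g - g'"] by (simp add: mult_diff_right)

lemma unit_iff_degree_0: "skew_unit \<sigma> f \<longleftrightarrow> f \<noteq> 0 \<and> Polynomial.degree f = 0"
proof
  assume "skew_unit \<sigma> f"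
  then obtain g where g: "f \<star> g = [:1:]" by (auto simp: skew_unit_def)
  then have "f \<noteq> 0" "g \<noteq> 0" by auto
  with g degree_mult[of f g] show "f \<noteq> 0 \<and> Polynomial.degree f = 0" by simp
next
  assume "f \<noteq> 0 \<and> Polynomial.degree f = 0"
  then obtain c where "f = [:c:]" "c \<noteq> 0" by (auto elim: degree_eq_zeroE)
  then show "skew_unit \<sigma> f"
    unfolding skew_unit_def
    by (intro exI[of _ "[:inverse c:]"]) (auto simp: monom_mult_monom simp flip: monom_0)
qed

section \<open>Right divisibility, right division and greatest common right divisors\<close>

lemma right_divides_trans:
  "right_divides \<sigma> f g \<Longrightarrow> right_divides \<sigma> g h \<Longrightarrow> right_divides \<sigma> f h"
  unfolding right_divides_def by (metis mult_assoc)

lemma right_divides_mult: "right_divides \<sigma> f (g \<star> f)"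
  by (auto simp: right_divides_def)

lemma right_divides_mult_left: "right_divides \<sigma> f h \<Longrightarrow> right_divides \<sigma> f (g \<star> h)"
  unfolding right_divides_def by (metis mult_assoc)

lemma right_divides_add:
  "right_divides \<sigma> f g \<Longrightarrow> right_divides \<sigma> f h \<Longrightarrow> right_divides \<sigma> f (g + h)"
  unfolding right_divides_def by (metis mult_add_left)

lemma right_divides_diff:
  "right_divides \<sigma> f g \<Longrightarrow> right_divides \<sigma> f h \<Longrightarrow> right_divides \<sigma> f (g - h)"
  unfolding right_divides_def by (metis mult_diff_left)

lemma right_divides_monic_antisym:
  assumes "right_divides \<sigma> g h" "Polynomial.degree g = Polynomial.degree h"
    and "Polynomial.lead_coeff g = 1" "Polynomial.lead_coeff h = 1"
  shows "g = h"
proof -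
  obtain q where q: "h = q \<star> g" using assms by (auto simp: right_divides_def)
  then have "q \<noteq> 0" "g \<noteq> 0" using assms by auto
  then have "Polynomial.degree q = 0" using q assms degree_mult[of q g] by simp
  then obtain c where c: "q = [:c:]" by (auto elim: degree_eq_zeroE)
  then have "c = 1" using q assms lead_coeff_mult[of q g] by simp
  with q c show ?thesis by simp
qed

lemma right_division:
  assumes "g \<noteq> 0"
  obtains q r where "f = q \<star> g + r" "r = 0 \<or> Polynomial.degree r < Polynomial.degree g"
proof (induction "Polynomial.degree f" arbitrary: f thesis rule: less_induct)
  case less
  show ?case
  proof (cases "f = 0 \<or> Polynomial.degree f < Polynomial.degree g")
    case True
    then show ?thesis using less.prems[of 0 f] by simp
  next
    case False
    define k where "k = Polynomial.degree f - Polynomial.degree g"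
    \<comment> \<open>Moving \<open>t^k\<close> past the leading coefficient of \<open>g\<close>
      applies \<sigma>^k to it, so with this \<open>c\<close> the product \<open>c t^k g\<close> has
      the leading coefficient of \<open>f\<close>.\<close>
    define c where "c = Polynomial.lead_coeff f * inverse ((\<sigma> ^^ k) (Polynomial.lead_coeff g))"
    let ?m = "Polynomial.monom c k"
    have c: "c \<noteq> 0" using False assms by (simp add: c_def)
    then have m: "?m \<noteq> 0" "Polynomial.degree ?m = k" by (simp_all add: degree_monom_eq)
    have deg: "Polynomial.degree (?m \<star> g) = Polynomial.degree f"
      using False m assms by (simp add: degree_mult k_def)
    have lc: "Polynomial.coeff (?m \<star> g) (Polynomial.degree f) = Polynomial.lead_coeff f"
      using lead_coeff_mult[of ?m g] assms deg m c unfolding deg m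
      by (simp add: c_def mult.assoc)
    show ?thesis
    proof (cases "f = ?m \<star> g")
      case True
      then show ?thesis using less.prems[of ?m 0] by simp
    next
      case ne: False
      have "Polynomial.degree (f - ?m \<star> g) < Polynomial.degree f"
      proof -
        have "Polynomial.degree (f - ?m \<star> g) \<le> Polynomial.degree f"
          using degree_diff_le[of f "Polynomial.degree f" "?m \<star> g"] deg by simp
        moreover have "Polynomial.degree (f - ?m \<star> g) \<noteq> Polynomial.degree f"
        proof
          assume eq: "Polynomial.degree (f - ?m \<star> g) = Polynomial.degree f"
          have "Polynomial.coeff (f - ?m \<star> g) (Polynomial.degree f) = 0" using lc by simp
          then have "f - ?m \<star> g = 0" unfolding eq[symmetric] by (simp only: leading_coeff_0_iff)
          then show False using ne by simp
        qed
        ultimately show ?thesis by simp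
      qed
      from less.hyps[OF this] obtain q r
        where "f - ?m \<star> g = q \<star> g + r" "r = 0 \<or> Polynomial.degree r < Polynomial.degree g" by metis
      then show ?thesis using less.prems[of "?m + q" r] by (simp add: mult_add_left algebra_simps)
    qed
  qed
qed

text \<open>Euclid's argument: a nonzero element of least degree in the left ideal \<open>I\<close>
  generated by \<open>f\<close> and \<open>h\<close> right-divides all of \<open>I\<close>, by right
  division.\<close>

lemma gcrd_exists:
  assumes "f \<noteq> 0"
  obtains g a b where "g = a \<star> f + b \<star> h" "Polynomial.lead_coeff g = 1"
    "right_divides \<sigma> g f" "right_divides \<sigma> g h"
proof -
  define I where "I = {a \<star> f + b \<star> h | a b. True}"
  have I_f: "f \<in> I" unfolding I_def using one_mult[of f] mult_0_left[of h]
    by (metis (mono_tags, lifting) add.right_neutral mem_Collect_eq)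
  have I_h: "h \<in> I" unfolding I_def using one_mult[of h] mult_0_left[of f]
    by (metis (mono_tags, lifting) add.left_neutral mem_Collect_eq)
  have I_diff: "x - q \<star> y \<in> I" if "x \<in> I" "y \<in> I" for x y q
  proof -
    from that obtain a b a' b' where "x = a \<star> f + b \<star> h" "y = a' \<star> f + b' \<star> h"
      by (auto simp: I_def)
    then have "x - q \<star> y = (a - q \<star> a') \<star> f + (b - q \<star> b') \<star> h"
      by (simp add: mult_diff_left mult_add_right mult_assoc)
    then show ?thesis by (auto simp: I_def)
  qed
  obtain g0 where g0: "g0 \<in> I" "g0 \<noteq> 0"
    and min: "\<And>y. y \<in> I \<Longrightarrow> y \<noteq> 0 \<Longrightarrow> Polynomial.degree g0 \<le> Polynomial.degree y"
    using ex_has_least_nat[of "\<lambda>y. y \<in> I \<and> y \<noteq> 0" f Polynomial.degree] I_f assms by blast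
  define c where "c = inverse (Polynomial.lead_coeff g0)"
  define g where "g = [:c:] \<star> g0"
  have c: "c \<noteq> 0" using g0 by (simp add: c_def)
  have g: "g \<noteq> 0" "Polynomial.degree g = Polynomial.degree g0"
    using c g0 by (simp_all add: g_def mult_eq_0_iff degree_mult)
  have lc: "Polynomial.lead_coeff g = 1"
    using lead_coeff_mult[of "[:c:]" g0] g0 c unfolding g_def[symmetric] by (simp add: c_def)
  \<comment> \<open>\<open>0\<close> lies in \<open>I\<close> as \<open>g0 - g0\<close>, and
    \<open>g\<close> is \<open>0 - (- c) g0\<close>.\<close>
  have g_I: "g \<in> I"
    using I_diff[of 0 g0 "- [:c:]"] I_diff[OF g0(1) g0(1), of "[:1:]"] g0
    by (simp add: g_def mult_minus_left del: minus_pCons)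
  have div: "right_divides \<sigma> g x" if "x \<in> I" for x
  proof -
    obtain q r where qr: "x = q \<star> g + r" "r = 0 \<or> Polynomial.degree r < Polynomial.degree g"
      using right_division[OF g(1)] by metis
    have "r \<in> I" using I_diff[OF that g_I, of q] qr(1) by simp
    then have "r = 0" using qr(2) min[of r] g(2) by force
    then show ?thesis using qr(1) by (simp add: right_divides_mult)
  qed
  from g_I obtain a b where "g = a \<star> f + b \<star> h" by (auto simp: I_def)
  then show thesis using that lc div I_f I_h by blast
qed

lemma skew_prod_Nil [simp]: "skew_prod \<sigma> [] = [:1:]"
  by (simp add: skew_prod_def)

lemma skew_prod_Cons: "skew_prod \<sigma> (f # fs) = f \<star> skew_prod \<sigma> fs"
  by (simp add: skew_prod_def)

lemma skew_prod_append: "skew_prod \<sigma> (fs @ gs) = skew_prod \<sigma> fs \<star> skew_prod \<sigma> gs"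
  by (induction fs) (simp_all add: skew_prod_Cons mult_assoc)

lemma skew_prod_snoc: "skew_prod \<sigma> (fs @ [g]) = skew_prod \<sigma> fs \<star> g"
  by (simp add: skew_prod_append skew_prod_Cons)

end

section \<open>Polynomials over a field up to constants\<close>

text \<open>Associatedness in F[x], with the constant made explicit because
  \<open>norms_match\<close> asks for the constants.\<close>

definition proportional :: "'k::field poly \<Rightarrow> 'k poly \<Rightarrow> bool" where
  "proportional p q \<longleftrightarrow> (\<exists>c. c \<noteq> 0 \<and> p = Polynomial.smult c q)"

lemma proportional_iff_dvd: "proportional p q \<longleftrightarrow> p dvd q \<and> q dvd p"
proof
  assume "proportional p q"
  then obtain c where "c \<noteq> 0" "p = Polynomial.smult c q" by (auto simp: proportional_def)
  then show "p dvd q \<and> q dvd p" by (simp add: smult_dvd dvd_smult)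
next
  assume *: "p dvd q \<and> q dvd p"
  show "proportional p q"
  proof (cases "q = 0")
    case True
    then show ?thesis using * by (auto simp: proportional_def intro: exI[of _ 1])
  next
    case False
    obtain k where k: "p = q * k" using * by auto
    then have p: "p \<noteq> 0" using * False by auto
    then have "Polynomial.degree p = Polynomial.degree q"
      using * False by (meson dvd_imp_degree_le le_antisym)
    then have "Polynomial.degree k = 0" using k p by (auto simp: degree_mult_eq)
    then obtain c where "k = [:c:]" by (auto elim: degree_eq_zeroE)
    then show ?thesis using k p by (auto simp: proportional_def intro!: exI[of _ c])
  qed
qed

lemma proportional_sym: "proportional p q \<Longrightarrow> proportional q p"
  by (auto simp: proportional_iff_dvd)

lemma proportional_trans: "proportional p q \<Longrightarrow> proportional q s \<Longrightarrow> proportional p s"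
  by (auto simp: proportional_iff_dvd intro: dvd_trans)

lemma proportional_refl: "proportional p p"
  by (simp add: proportional_iff_dvd)

lemma proportional_mult:
  "proportional p q \<Longrightarrow> proportional p' q' \<Longrightarrow> proportional (p * p') (q * q')"
  by (auto simp: proportional_iff_dvd mult_dvd_mono)

lemma proportional_mult_cancel:
  assumes "proportional (p * s) (q * s')" "proportional s s'" "s' \<noteq> 0"
  shows "proportional p q"
proof -
  have "s \<noteq> 0" using assms by (auto simp: proportional_def)
  moreover have "proportional (p * s) (q * s)"
    using proportional_trans[OF assms(1)] proportional_mult[OF proportional_refl, of s' s q] assms(2)
    by (auto dest: proportional_sym)
  ultimately show ?thesis by (simp add: proportional_iff_dvd)
qed

lemma proportional_degree: "proportional p q \<Longrightarrow> Polynomial.degree p = Polynomial.degree q"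
  by (auto simp: proportional_def)

lemma proportional_irreducible:
  assumes "proportional p q" "irreducible q"
  shows "irreducible p"
proof -
  obtain c where c: "c \<noteq> 0" "p = [:c:] * q" using assms by (auto simp: proportional_def)
  then have "is_unit [:c:]" by (simp add: is_unit_const_poly_iff dvd_field_iff)
  then show ?thesis using assms c by (simp only: irreducible_mult_unit_left)
qed

lemma irreducible_degree_pos: "irreducible (p :: 'k::field poly) \<Longrightarrow> Polynomial.degree p > 0"
  by (metis gr0I irreducible_def is_unit_iff_degree)

lemma dvd_irreducible_proportional:
  fixes p q :: "'k::field poly"
  assumes "p dvd q" "irreducible q" "Polynomial.degree p > 0"
  shows "proportional p q"
  using assms unfolding proportional_iff_dvd by (metis irreducibleD' is_unit_iff_degree less_irrefl not_less0 dvd_0_left_iff Polynomial.degree_0)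

text \<open>A nonconstant divisor of least degree has no proper factorization.\<close>

lemma irreducible_factor_exists:
  fixes p :: "'k::field poly"
  assumes "Polynomial.degree p > 0"
  obtains q where "irreducible q" "q dvd p"
proof -
  obtain q where q: "Polynomial.degree q > 0" "q dvd p"
    and min: "\<And>s. Polynomial.degree s > 0 \<Longrightarrow> s dvd p \<Longrightarrow> Polynomial.degree q \<le> Polynomial.degree s"
    using ex_has_least_nat[of "\<lambda>q. Polynomial.degree q > 0 \<and> q dvd p" p Polynomial.degree] assms
    by auto
  have "irreducible q"
  proof (rule irreducibleI)
    show "q \<noteq> 0" using q by auto
    then show "\<not> is_unit q" using q by (simp add: is_unit_iff_degree)
  next
    fix a b assume ab: "q = a * b"
    with q have nz: "a \<noteq> 0" "b \<noteq> 0" by auto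
    then have deg: "Polynomial.degree q = Polynomial.degree a + Polynomial.degree b"
      using ab by (simp add: degree_mult_eq)
    have "a dvd p" "b dvd p" using ab q by (auto intro: dvd_trans)
    with min[of a] min[of b] deg have "Polynomial.degree a = 0 \<or> Polynomial.degree b = 0" by linarith
    then show "is_unit a \<or> is_unit b" using nz by (simp add: is_unit_iff_degree)
  qed
  with q that show thesis by blast
qed

text \<open>Unique factorization in F[x]: each \<open>q\<close> is prime, so it divides some entry
  \<open>h\<close> of \<open>hs\<close>, is proportional to it, and both are cancelled. The
  rearrangement \<open>ks\<close> records which entry belongs to which \<open>q\<close>.\<close>

lemma prod_list_proportional_permutation:
  assumes "proportional (prod_list qs) (prod_list hs)"
    and "\<forall>q\<in>set qs. irreducible q" "\<forall>h\<in>set hs. irreducible (h :: 'k::field poly)"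
  shows "\<exists>ks. mset ks = mset hs \<and> list_all2 proportional qs ks"
  using assms
proof (induction qs arbitrary: hs)
  case Nil
  have "hs = []"
  proof (cases hs)
    case (Cons h hs')
    then have "h dvd 1" using Nil by (auto simp: proportional_iff_dvd intro: dvd_trans[of h "h * prod_list hs'"])
    then show ?thesis using Nil Cons by (auto simp: irreducible_def)
  qed simp
  then show ?case by simp
next
  case (Cons q qs)
  have "q dvd prod_list hs"
    using Cons.prems(1) by (auto simp: proportional_iff_dvd intro: dvd_trans[of q "q * prod_list qs"])
  moreover have "prime_elem q" using Cons.prems(2) by (simp add: field_poly_irreducible_imp_prime)
  ultimately obtain h where h: "h \<in> set hs" "q dvd h"
    by (metis prime_elem_dvd_prod_msetE prod_mset_prod_list set_mset_mset)
  then obtain xs ys where hs: "hs = xs @ h # ys" by (meson split_list)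
  have qh: "proportional q h"
    using h Cons.prems by (intro dvd_irreducible_proportional irreducible_degree_pos) auto
  have "h \<noteq> 0" using Cons.prems(3) h by auto
  moreover have "proportional (prod_list qs * q) (prod_list (xs @ ys) * h)"
    using Cons.prems(1) by (simp add: hs algebra_simps)
  ultimately have "proportional (prod_list qs) (prod_list (xs @ ys))"
    using qh by (blast intro: proportional_mult_cancel)
  with Cons.IH[of "xs @ ys"] Cons.prems obtain ks
    where "mset ks = mset (xs @ ys)" "list_all2 proportional qs ks" by (auto simp: hs)
  then show ?case using qh by (intro exI[of _ "h # ks"]) (simp add: hs)
qed

section \<open>Factorizations controlled by a norm\<close>

text \<open>\<open>Z p\<close> stands for p(x), \<open>\<nu>\<close> for the reduced norm read as a
  polynomial, and \<open>r\<close> for the degree of the central simple algebra. The factorization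
  argument sees the algebra only through these properties.\<close>

locale skew_norm = skew_poly \<sigma> for \<sigma> :: "'a::division_ring \<Rightarrow> 'a" +
  fixes Z :: "'k::field poly \<Rightarrow> 'a poly" and \<nu> :: "'a poly \<Rightarrow> 'k poly" and d r :: nat
  assumes Z_add: "Z (p + q) = Z p + Z q"
    and Z_mult: "Z (p * q) = Z p \<star> Z q"
    and Z_1: "Z 1 = [:1:]"
    and Z_central: "Z p \<star> g = g \<star> Z p"
    and \<nu>_mult: "\<nu> (f \<star> g) = \<nu> f * \<nu> g"
    and \<nu>_Z: "\<nu> (Z p) = p ^ r"
    and \<nu>_eq_0_iff: "\<nu> f = 0 \<longleftrightarrow> f = 0"
    and degree_\<nu>: "Polynomial.degree (\<nu> f) = d * Polynomial.degree f"
    and d_pos: "d > 0"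
    and central_multiple: "g \<noteq> 0 \<Longrightarrow> \<exists>p. p \<noteq> 0 \<and> right_divides \<sigma> g (Z p)"
begin

section \<open>Central multiples and the norm\<close>

lemma \<nu>_1: "\<nu> [:1:] = 1"
  using \<nu>_Z[of 1] by (simp add: Z_1)

lemma Z_diff: "Z (p - q) = Z p - Z q"
  using Z_add[of "p - q" q] by (simp add: algebra_simps)

lemma \<nu>_skew_prod: "\<nu> (skew_prod \<sigma> fs) = prod_list (map \<nu> fs)"
  by (induction fs) (simp_all add: \<nu>_1 skew_prod_Cons \<nu>_mult)

text \<open>With \<open>Z p = y f\<close> and \<open>Z q = z g\<close>, the central
  \<open>Z p\<close> can be moved past \<open>z\<close>:
  \<open>Z p z g = z Z p g = z y f g\<close>.\<close>

lemma right_divides_Z_mult: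
  "right_divides \<sigma> f (Z p) \<Longrightarrow> right_divides \<sigma> g (Z q) \<Longrightarrow> right_divides \<sigma> (f \<star> g) (Z (p * q))"
proof -
  assume "right_divides \<sigma> f (Z p)" "right_divides \<sigma> g (Z q)"
  then obtain y z where yz: "Z p = y \<star> f" "Z q = z \<star> g" by (auto simp: right_divides_def)
  have "Z (p * q) = Z p \<star> (z \<star> g)" by (simp add: Z_mult yz)
  also have "\<dots> = z \<star> Z p \<star> g" by (metis mult_assoc Z_central)
  also have "\<dots> = z \<star> y \<star> (f \<star> g)" by (simp add: yz mult_assoc)
  finally show ?thesis by (auto simp: right_divides_def)
qed

text \<open>If \<open>g\<close> and \<open>Z \<pi>\<close> were right coprime, then \<open>\<pi>\<close> could be cancelled from the least central
  left multiple of \<open>g\<close>.\<close>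

lemma common_divisor_of_irreducible:
  assumes g: "g \<noteq> 0" and \<pi>: "irreducible \<pi>" "\<pi> dvd \<nu> g"
  obtains h a b where "h = a \<star> g + b \<star> Z \<pi>" "Polynomial.lead_coeff h = 1"
    "right_divides \<sigma> h g" "right_divides \<sigma> h (Z \<pi>)" "Polynomial.degree h > 0"
proof -
  obtain p where p: "p \<noteq> 0" "right_divides \<sigma> g (Z p)"
    and min: "\<And>q. q \<noteq> 0 \<Longrightarrow> right_divides \<sigma> g (Z q) \<Longrightarrow> Polynomial.degree p \<le> Polynomial.degree q"
    using ex_has_least_nat[of "\<lambda>p. p \<noteq> 0 \<and> right_divides \<sigma> g (Z p)" _ Polynomial.degree]
      central_multiple[OF g] by metis
  obtain y where y: "Z p = y \<star> g" using p by (auto simp: right_divides_def)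
  \<comment> \<open>Taking norms in \<open>Z p = y g\<close> shows that every prime factor of
    \<open>\<nu> g\<close> divides \<open>p\<close>.\<close>
  have "p ^ r = \<nu> y * \<nu> g" using \<nu>_Z[of p] by (simp add: y \<nu>_mult)
  then have "\<pi> dvd p ^ r" using \<pi> by simp
  moreover have "prime_elem \<pi>" using \<pi> by (simp add: field_poly_irreducible_imp_prime)
  ultimately have "\<pi> dvd p" using prime_elem_dvd_power by blast
  then obtain q where q: "p = \<pi> * q" by auto
  then have nz: "\<pi> \<noteq> 0" "q \<noteq> 0" using p by auto
  have deg_q: "Polynomial.degree q < Polynomial.degree p"
    using irreducible_degree_pos[OF \<pi>(1)] nz q by (simp add: degree_mult_eq)
  obtain h a b where h: "h = a \<star> g + b \<star> Z \<pi>" "Polynomial.lead_coeff h = 1"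
    "right_divides \<sigma> h g" "right_divides \<sigma> h (Z \<pi>)"
    by (rule gcrd_exists[OF g])
  have "Polynomial.degree h > 0"
  proof (rule ccontr)
    assume "\<not> Polynomial.degree h > 0"
    then have "h = [:1:]" using h(2) by (auto elim!: degree_eq_zeroE)
    \<comment> \<open>The Bezout relation \<open>1 = a g + b Z \<pi>\<close> is multiplied by
      \<open>Z q\<close>; in the second term, \<open>Z q Z \<pi> = Z p\<close> is a left multiple of
      \<open>g\<close>.\<close>
    then have "Z q = Z q \<star> (a \<star> g + b \<star> Z \<pi>)" using h(1) by (metis mult_one)
    also have "\<dots> = Z q \<star> a \<star> g + b \<star> (Z q \<star> Z \<pi>)"
      by (simp add: mult_add_right) (metis mult_assoc Z_central)
    also have "Z q \<star> Z \<pi> = Z p" by (metis q Z_mult Z_central)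
    finally have "right_divides \<sigma> g (Z q)"
      using p(2) by (metis right_divides_add right_divides_mult right_divides_mult_left)
    then show False using min[of q] nz deg_q by simp
  qed
  with h that show thesis by blast
qed

text \<open>A statement of Cayley-Hamilton type. For proper products it follows from the factors by
  \<open>right_divides_Z_mult\<close>. If \<open>g\<close> has no proper factors, its common divisor
  of positive degree with \<open>Z \<pi>\<close> is \<open>g\<close> up to a unit, so
  \<open>g\<close> already right-divides \<open>Z \<pi>\<close>.\<close>

lemma right_divides_Z_norm: "g \<noteq> 0 \<Longrightarrow> right_divides \<sigma> g (Z (\<nu> g))"
proof (induction "Polynomial.degree g" arbitrary: g rule: less_induct)
  case less
  consider "Polynomial.degree g = 0"
    | y z where "g = y \<star> z" "Polynomial.degree y < Polynomial.degree g" "Polynomial.degree z < Polynomial.degree g"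
    | "Polynomial.degree g > 0" "\<And>y z. g = y \<star> z \<Longrightarrow>
        Polynomial.degree y = Polynomial.degree g \<or> Polynomial.degree z = Polynomial.degree g"
  proof (cases "Polynomial.degree g = 0 \<or> (\<exists>y z. g = y \<star> z \<and>
      Polynomial.degree y < Polynomial.degree g \<and> Polynomial.degree z < Polynomial.degree g)")
    case False
    have "Polynomial.degree y = Polynomial.degree g \<or> Polynomial.degree z = Polynomial.degree g"
      if "g = y \<star> z" for y z
      using that False less.prems degree_mult[of y z] mult_eq_0_iff[of y z] by fastforce
    with False that(3) show thesis by blast
  qed (use that(1,2) in blast)
  then show ?case
  proof cases
    case 1
    then have "skew_unit \<sigma> g" using less.prems by (simp add: unit_iff_degree_0)
    then obtain y where "y \<star> g = [:1:]" by (auto simp: skew_unit_def)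
    then have "Z (\<nu> g) = Z (\<nu> g) \<star> y \<star> g" by (simp add: mult_assoc)
    then show ?thesis by (auto simp: right_divides_def)
  next
    case 2
    then have "y \<noteq> 0" "z \<noteq> 0" using less.prems by auto
    with less.hyps[OF 2(2)] less.hyps[OF 2(3)] show ?thesis
      unfolding 2(1) \<nu>_mult by (intro right_divides_Z_mult)
  next
    case 3
    have "Polynomial.degree (\<nu> g) > 0" using 3 d_pos by (simp add: degree_\<nu>)
    then obtain \<pi> where \<pi>: "irreducible \<pi>" "\<pi> dvd \<nu> g" by (rule irreducible_factor_exists)
    obtain h a b where h: "right_divides \<sigma> h g" "right_divides \<sigma> h (Z \<pi>)" "Polynomial.degree h > 0"
      by (rule common_divisor_of_irreducible[OF less.prems \<pi>])
    obtain q where q: "g = q \<star> h" using h by (auto simp: right_divides_def)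
    then have nz: "q \<noteq> 0" "h \<noteq> 0" using less.prems by auto
    have "Polynomial.degree q = 0"
      using 3(2)[OF q] degree_mult[OF nz] h(3) by (auto simp: q[symmetric])
    then have "skew_unit \<sigma> q" using nz by (simp add: unit_iff_degree_0)
    then obtain s where "s \<star> q = [:1:]" by (auto simp: skew_unit_def)
    then have "h = s \<star> g" by (simp add: q flip: mult_assoc)
    then have "right_divides \<sigma> g h" by (simp add: right_divides_mult)
    then have "right_divides \<sigma> g (Z \<pi>)" using h(2) by (rule right_divides_trans)
    moreover obtain k where "\<nu> g = k * \<pi>" using \<pi>(2) by (metis dvd_div_mult_self)
    ultimately show ?thesis by (simp add: Z_mult right_divides_mult_left)
  qed
qed

text \<open>By \<open>right_divides_Z_norm\<close>, the polynomials \<open>p\<close> such that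
  \<open>f\<close> right-divides \<open>Z p\<close> include all multiples of \<open>\<nu> f\<close>;
  fullness says that there are no others. Divisibility, in place of equality of degrees, lets the
  property pass to factors by cancellation.\<close>

definition full :: "'a poly \<Rightarrow> bool" where
  "full f \<longleftrightarrow> f \<noteq> 0 \<and> (\<forall>p. right_divides \<sigma> f (Z p) \<longrightarrow> \<nu> f dvd p)"

text \<open>If \<open>Z p\<close> is a left multiple of \<open>f\<close>, then
  \<open>Z (p * \<nu> g)\<close> is one of \<open>f g\<close>. So \<open>\<nu> f * \<nu> g\<close>
  divides \<open>p * \<nu> g\<close>, and \<open>\<nu> g\<close> cancels. The argument for
  \<open>g\<close> is symmetric.\<close>

lemma full_mult:
  assumes "full (f \<star> g)"
  shows "full f" "full g"
proof -
  have nz: "f \<noteq> 0" "g \<noteq> 0" using assms by (auto simp: full_def)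
  then have \<nu>_nz: "\<nu> f \<noteq> 0" "\<nu> g \<noteq> 0" by (simp_all add: \<nu>_eq_0_iff)
  have *: "\<nu> f * \<nu> g dvd p * q"
    if "right_divides \<sigma> f (Z p)" "right_divides \<sigma> g (Z q)" for p q
    using assms right_divides_Z_mult[OF that] by (auto simp: full_def \<nu>_mult)
  show "full f"
    unfolding full_def using nz \<nu>_nz *[OF _ right_divides_Z_norm[OF nz(2)]] by simp
  show "full g"
    unfolding full_def using nz \<nu>_nz *[OF right_divides_Z_norm[OF nz(1)]] by simp
qed

lemma full_skew_prod: "full (skew_prod \<sigma> fs) \<Longrightarrow> g \<in> set fs \<Longrightarrow> full g"
  by (induction fs) (auto simp: skew_prod_Cons dest: full_mult)

text \<open>The remainder of \<open>p\<close> modulo \<open>\<nu> f\<close> again yields a left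
  multiple of \<open>f\<close>; by the degree assumption it cannot be nonzero.\<close>

lemma full_if_degree_minimal:
  assumes f: "f \<noteq> 0"
    and min: "\<And>p. p \<noteq> 0 \<Longrightarrow> right_divides \<sigma> f (Z p) \<Longrightarrow> d * Polynomial.degree f \<le> Polynomial.degree p"
  shows "full f"
  unfolding full_def
proof (intro conjI f allI impI)
  fix p assume p: "right_divides \<sigma> f (Z p)"
  have nz: "\<nu> f \<noteq> 0" using f by (simp add: \<nu>_eq_0_iff)
  have "Z (p mod \<nu> f) = Z p - Z (p div \<nu> f) \<star> Z (\<nu> f)"
    by (simp add: Z_mult[symmetric] Z_diff[symmetric] minus_div_mult_eq_mod)
  then have "right_divides \<sigma> f (Z (p mod \<nu> f))"
    using p right_divides_Z_norm[OF f] by (simp add: right_divides_diff right_divides_mult_left)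
  then have "p mod \<nu> f = 0"
    using min[of "p mod \<nu> f"] degree_mod_less[OF nz, of p] by (force simp: degree_\<nu>)
  then show "\<nu> f dvd p" by auto
qed

lemma irreducible_if_norm_irreducible:
  assumes "irreducible (\<nu> g)"
  shows "skew_irreducible \<sigma> g"
proof -
  have g: "g \<noteq> 0" using assms \<nu>_eq_0_iff[of g] by auto
  have "Polynomial.degree g > 0"
    using irreducible_degree_pos[OF assms] by (simp add: degree_\<nu>)
  then have "\<not> skew_unit \<sigma> g" by (simp add: unit_iff_degree_0)
  moreover have "Polynomial.degree y = 0 \<or> Polynomial.degree z = 0" if "g = y \<star> z" for y z
  proof -
    have "is_unit (\<nu> y) \<or> is_unit (\<nu> z)"
      using irreducibleD[OF assms, of "\<nu> y" "\<nu> z"] that by (simp add: \<nu>_mult)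
    moreover have "\<nu> y \<noteq> 0" "\<nu> z \<noteq> 0" using that g by (auto simp: \<nu>_eq_0_iff)
    ultimately show ?thesis using d_pos by (simp add: is_unit_iff_degree degree_\<nu>)
  qed
  ultimately show ?thesis unfolding skew_irreducible_def by fastforce
qed

text \<open>A right factor of \<open>f\<close> is full itself. Hence the norm of the common divisor
  divides \<open>\<pi>\<close>, and not merely a power of \<open>\<pi>\<close>.\<close>

lemma full_common_divisor:
  assumes f: "full f" and \<pi>: "irreducible \<pi>" "\<pi> dvd \<nu> f"
  obtains g a b where "g = a \<star> f + b \<star> Z \<pi>" "Polynomial.lead_coeff g = 1" "right_divides \<sigma> g f"
    "proportional (\<nu> g) \<pi>" "Polynomial.degree g > 0"
proof -
  have "f \<noteq> 0" using f by (simp add: full_def)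
  then obtain h a b where h: "h = a \<star> f + b \<star> Z \<pi>" "Polynomial.lead_coeff h = 1"
    "right_divides \<sigma> h f" "right_divides \<sigma> h (Z \<pi>)" "Polynomial.degree h > 0"
    using common_divisor_of_irreducible \<pi> by metis
  have "full h" using h(3) f by (auto simp: right_divides_def dest: full_mult)
  then have "\<nu> h dvd \<pi>" using h(4) by (simp add: full_def)
  then have "proportional (\<nu> h) \<pi>"
    using \<pi>(1) h(5) d_pos by (intro dvd_irreducible_proportional) (simp_all add: degree_\<nu>)
  with h that show thesis by blast
qed

text \<open>A converse to \<open>irreducible_if_norm_irreducible\<close>: the right factor of
  \<open>f\<close> with norm \<open>\<pi>\<close> has positive degree, so it is \<open>f\<close> up
  to a unit.\<close>

lemma full_irreducible_norm:
  assumes f: "full f" and irr: "skew_irreducible \<sigma> f"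
  shows "irreducible (\<nu> f)"
proof -
  have f0: "f \<noteq> 0" using f by (simp add: full_def)
  then have "Polynomial.degree f > 0" using irr by (auto simp: skew_irreducible_def unit_iff_degree_0)
  then have "Polynomial.degree (\<nu> f) > 0" using d_pos by (simp add: degree_\<nu>)
  then obtain \<pi> where \<pi>: "irreducible \<pi>" "\<pi> dvd \<nu> f" by (rule irreducible_factor_exists)
  obtain g where g: "right_divides \<sigma> g f" "proportional (\<nu> g) \<pi>" "Polynomial.degree g > 0"
    using full_common_divisor[OF f \<pi>] by metis
  obtain q where q: "f = q \<star> g" using g by (auto simp: right_divides_def)
  then have nz: "q \<noteq> 0" "g \<noteq> 0" using f0 by auto
  then have "Polynomial.degree q = 0"
    using irr degree_mult[OF nz] g(3) q unfolding skew_irreducible_def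
    by (metis One_nat_def Suc_leI add.commute less_add_same_cancel2 not_gr_zero)
  then have "is_unit (\<nu> q)" using nz by (simp add: is_unit_iff_degree degree_\<nu> \<nu>_eq_0_iff)
  then have "proportional (\<nu> q) 1" by (simp add: proportional_iff_dvd)
  then have "proportional (\<nu> f) (1 * \<pi>)" using g(2) unfolding q \<nu>_mult by (rule proportional_mult)
  then show ?thesis using \<pi>(1) by (simp add: proportional_irreducible)
qed

text \<open>A right factor of a full \<open>f\<close> with norm \<open>\<pi>\<close> divides both \<open>f\<close> and \<open>Z \<pi>\<close>, hence it is their
  greatest common right divisor.\<close>

lemma full_right_factor:
  assumes f: "full f" and \<pi>: "irreducible \<pi>" "\<pi> dvd \<nu> f"
  shows "\<exists>!g. Polynomial.lead_coeff g = 1 \<and> right_divides \<sigma> g f \<and> proportional (\<nu> g) \<pi>"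
proof -
  obtain g a b where g: "g = a \<star> f + b \<star> Z \<pi>" "Polynomial.lead_coeff g = 1" "right_divides \<sigma> g f"
    "proportional (\<nu> g) \<pi>"
    using full_common_divisor[OF f \<pi>] by metis
  have "g' = g" if g': "Polynomial.lead_coeff g' = 1" "right_divides \<sigma> g' f" "proportional (\<nu> g') \<pi>" for g'
  proof (rule right_divides_monic_antisym)
    have "g' \<noteq> 0" using g'(1) by auto
    then have "right_divides \<sigma> g' (Z (\<nu> g'))" by (rule right_divides_Z_norm)
    moreover obtain k where "\<pi> = k * \<nu> g'"
      using g'(3) by (metis proportional_iff_dvd dvd_div_mult_self)
    ultimately have "right_divides \<sigma> g' (Z \<pi>)" by (simp add: Z_mult right_divides_mult_left)
    then show "right_divides \<sigma> g' g"
      using g'(2) unfolding g(1) by (intro right_divides_add right_divides_mult_left)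
    have "d * Polynomial.degree g' = d * Polynomial.degree g"
      using g(4) g'(3) by (metis proportional_degree degree_\<nu>)
    then show "Polynomial.degree g' = Polynomial.degree g" using d_pos by simp
  qed (use g g' in auto)
  with g show ?thesis by blast
qed

text \<open>Reverse induction on \<open>hs\<close>, since \<open>full_right_factor\<close>
  determines the last factor and the cofactor is again full and monic. Irreducibility of the factors
  is a consequence of their norms and is added in
  \<open>full_ordered_factorization_ex1\<close>.\<close>

lemma full_factorization_ex1:
  assumes "full f" "Polynomial.lead_coeff f = 1" "\<forall>p\<in>set hs. irreducible p"
    and "proportional (\<nu> f) (prod_list hs)"
  shows "\<exists>!fs. f = skew_prod \<sigma> fs \<and>
    list_all2 (\<lambda>g p. Polynomial.lead_coeff g = 1 \<and> proportional (\<nu> g) p) fs hs"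
  using assms
proof (induction hs arbitrary: f rule: rev_induct)
  case Nil
  then have "Polynomial.degree f = 0"
    using d_pos by (auto dest!: proportional_degree simp: degree_\<nu>)
  then have "f = [:1:]" using Nil.prems by (auto elim!: degree_eq_zeroE)
  then show ?case by auto
next
  case (snoc p hs)
  let ?M = "\<lambda>g p. Polynomial.lead_coeff g = 1 \<and> proportional (\<nu> g) p"
  have p: "irreducible p" "p dvd \<nu> f"
    using snoc.prems by (auto simp: proportional_iff_dvd intro: dvd_trans[of p "prod_list hs * p"])
  obtain g where g: "Polynomial.lead_coeff g = 1" "right_divides \<sigma> g f" "proportional (\<nu> g) p"
    and uniq: "\<And>g'. ?M g' p \<Longrightarrow> right_divides \<sigma> g' f \<Longrightarrow> g' = g"
    using full_right_factor[OF snoc.prems(1) p] by blast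
  obtain q where q: "f = q \<star> g" using g by (auto simp: right_divides_def)
  have "g \<noteq> 0" using g by auto
  have "full q" using snoc.prems(1) unfolding q by (rule full_mult)
  moreover have "Polynomial.lead_coeff q = 1"
    using lead_coeff_mult[of q g] g(1) snoc.prems(2) by (simp add: q)
  moreover have "proportional (\<nu> q) (prod_list hs)"
    using snoc.prems(4) g(3) p(1) unfolding q \<nu>_mult
    by (intro proportional_mult_cancel[of "\<nu> q" "\<nu> g" _ p]) auto
  ultimately have ex1: "\<exists>!fs. q = skew_prod \<sigma> fs \<and> list_all2 ?M fs hs"
    using snoc.prems(3) by (intro snoc.IH) auto
  then obtain fs where fs: "q = skew_prod \<sigma> fs" "list_all2 ?M fs hs" by (elim ex1E conjE)
  have fs_uniq: "fs' = fs" if "q = skew_prod \<sigma> fs'" "list_all2 ?M fs' hs" for fs'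
    using Uniq_D[OF ex1_iff_ex_Uniq[THEN iffD1, OF ex1, THEN conjunct2]] fs that by simp
  show ?case
  proof (rule ex1I[of _ "fs @ [g]"], goal_cases)
    case 1
    then show ?case using fs g by (simp add: q skew_prod_snoc list_all2_appendI)
  next
    case (2 gs)
    then obtain gs' g' where gs: "gs = gs' @ [g']" "list_all2 ?M gs' hs" "?M g' p"
      by (auto simp: list_all2_append2 list_all2_Cons2)
    then have f: "f = skew_prod \<sigma> gs' \<star> g'" using 2 by (simp add: skew_prod_snoc)
    then have "g' = g" using uniq gs(3) by (simp add: right_divides_mult)
    moreover from this have "q = skew_prod \<sigma> gs'"
      using f q \<open>g \<noteq> 0\<close> by (auto intro: mult_right_cancel)
    ultimately show ?case using gs fs_uniq by simp
  qed
qed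

section \<open>Factorizations and orderings of the norm factors\<close>

lemma full_ordered_factorization_ex1:
  assumes "full f" "Polynomial.lead_coeff f = 1" "\<forall>p\<in>set hs. irreducible p"
    and "proportional (\<nu> f) (prod_list hs)"
  shows "\<exists>!fs. fs \<in> factorizations \<sigma> f \<and> list_all2 (\<lambda>g. proportional (\<nu> g)) fs hs"
proof -
  have irr: "skew_irreducible \<sigma> g" if "g \<in> set fs" "list_all2 (\<lambda>g. proportional (\<nu> g)) fs hs" for g fs
    using that assms(3) unfolding list_all2_conv_all_nth in_set_conv_nth
    by (metis irreducible_if_norm_irreducible proportional_irreducible nth_mem)
  have lc: "list_all2 (\<lambda>g p. Polynomial.lead_coeff g = 1 \<and> proportional (\<nu> g) p) fs hs \<longleftrightarrow>
    (\<forall>g\<in>set fs. Polynomial.lead_coeff g = 1) \<and> list_all2 (\<lambda>g. proportional (\<nu> g)) fs hs" for fs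
    by (simp add: list_all2_conv_all_nth all_set_conv_all_nth del: One_nat_def) blast
  have "fs \<in> factorizations \<sigma> f \<and> list_all2 (\<lambda>g. proportional (\<nu> g)) fs hs \<longleftrightarrow>
    f = skew_prod \<sigma> fs \<and> list_all2 (\<lambda>g p. Polynomial.lead_coeff g = 1 \<and> proportional (\<nu> g) p) fs hs" for fs
    unfolding lc factorizations_def mem_Collect_eq using irr[of _ fs] by blast
  then show ?thesis using full_factorization_ex1[OF assms] by simp
qed

text \<open>The factors are full and irreducible, so their norms are irreducible, and unique
  factorization in F[x] applies to them.\<close>

lemma full_factorization_norms:
  assumes f: "full f" and hs: "\<forall>p\<in>set hs. irreducible p" "proportional (\<nu> f) (prod_list hs)"
    and fs: "fs \<in> factorizations \<sigma> f"
  shows "\<exists>ks. mset ks = mset hs \<and> list_all2 (\<lambda>g. proportional (\<nu> g)) fs ks"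
proof -
  have fs': "f = skew_prod \<sigma> fs" "\<forall>g\<in>set fs. skew_irreducible \<sigma> g"
    using fs by (auto simp: factorizations_def)
  have "\<exists>ks. mset ks = mset hs \<and> list_all2 proportional (map \<nu> fs) ks"
    using hs fs' full_skew_prod f full_irreducible_norm
    by (intro prod_list_proportional_permutation) (auto simp: \<nu>_skew_prod)
  then show ?thesis by (simp add: list_all2_map1)
qed

text \<open>Sending an ordering of \<open>hs\<close> to the factorization with these norms is a
  bijection. It is surjective by \<open>full_factorization_norms\<close>. It is injective because
  two orderings for the same factorization are proportional entry by entry, and different entries of
  \<open>hs\<close> are not proportional.\<close>

lemma card_full_factorizations:
  assumes f: "full f" "Polynomial.lead_coeff f = 1"
    and hs: "\<forall>p\<in>set hs. irreducible p" "proportional (\<nu> f) (prod_list hs)"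
    and distinct: "\<forall>i<length hs. \<forall>k<length hs. i \<noteq> k \<longrightarrow> \<not> hs ! i dvd hs ! k"
  shows "card (factorizations \<sigma> f) = fact (length hs)"
proof -
  let ?M = "list_all2 (\<lambda>g. proportional (\<nu> g))"
  have dist: "distinct hs" using distinct unfolding distinct_conv_nth by (metis dvd_refl)
  have inj: "p = q" if "p \<in> set hs" "q \<in> set hs" "proportional p q" for p q
    using that distinct unfolding in_set_conv_nth proportional_iff_dvd by metis
  define K where "K = permutations_of_set (set hs)"
  have K: "ks \<in> K \<longleftrightarrow> mset ks = mset hs" for ks
    using dist by (metis K_def mset_set_set permutations_of_multisetI permutations_of_multisetD
        permutations_of_set_altdef finite_set)
  have "\<exists>!fs. fs \<in> factorizations \<sigma> f \<and> ?M fs ks" if "ks \<in> K" for ks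
  proof (rule full_ordered_factorization_ex1[OF f])
    have ks: "mset ks = mset hs" using that K by simp
    then show "\<forall>p\<in>set ks. irreducible p" using hs(1) by (metis set_mset_mset)
    have "prod_list ks = prod_list hs" using ks by (metis prod_mset_prod_list)
    then show "proportional (\<nu> f) (prod_list ks)" using hs(2) by simp
  qed
  then obtain F where F: "\<And>ks. ks \<in> K \<Longrightarrow> F ks \<in> factorizations \<sigma> f \<and> ?M (F ks) ks"
    and F_uniq: "\<And>ks fs. ks \<in> K \<Longrightarrow> fs \<in> factorizations \<sigma> f \<Longrightarrow> ?M fs ks \<Longrightarrow> fs = F ks"
    by metis
  have "bij_betw F K (factorizations \<sigma> f)"
  proof (rule bij_betw_imageI)
    show "inj_on F K"
    proof (rule inj_onI)
      fix ks ks' assume ks: "ks \<in> K" "ks' \<in> K" "F ks = F ks'"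
      then have M: "?M (F ks) ks" "?M (F ks) ks'" using F by metis+
      show "ks = ks'"
      proof (rule nth_equalityI)
        show "length ks = length ks'" using M by (metis list_all2_lengthD)
        fix i assume i: "i < length ks"
        have "proportional (ks ! i) (ks' ! i)"
          using M i by (metis list_all2_conv_all_nth proportional_sym proportional_trans)
        moreover have "ks ! i \<in> set hs" "ks' ! i \<in> set hs"
          using ks K i M by (metis list_all2_lengthD nth_mem set_mset_mset)+
        ultimately show "ks ! i = ks' ! i" using inj by blast
      qed
    qed
    show "F ` K = factorizations \<sigma> f"
    proof (intro subset_antisym subsetI)
      fix fs assume "fs \<in> F ` K"
      then show "fs \<in> factorizations \<sigma> f" using F by blast
    next
      fix fs assume fs: "fs \<in> factorizations \<sigma> f"
      then obtain ks where "mset ks = mset hs" "?M fs ks"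
        using full_factorization_norms[OF f(1) hs] by blast
      then show "fs \<in> F ` K" using F_uniq[of ks fs] fs K by blast
    qed
  qed
  then have "card (factorizations \<sigma> f) = card K" by (metis bij_betw_same_card)
  also have "\<dots> = fact (length hs)" using dist by (simp add: K_def distinct_card)
  finally show ?thesis .
qed

end

section \<open>Determinants and fractions of polynomials\<close>

text \<open>The entry at (p, q) has degree at most (D + wt q - wt p) / n, written here without
  subtraction. A permutation meets each row and each column once, so the weights cancel in every
  Leibniz term.\<close>

lemma degree_det_le:
  fixes M :: "'k::field poly mat"
  assumes M: "M \<in> carrier_mat m m"
    and bound: "\<And>p q. p < m \<Longrightarrow> q < m \<Longrightarrow> M $$ (p, q) \<noteq> 0 \<Longrightarrow>
      n * Polynomial.degree (M $$ (p, q)) + wt p \<le> D + wt q"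
    and n: "n > 0"
  shows "n * Polynomial.degree (det M) \<le> m * D"
proof -
  have "Polynomial.degree (signof \<pi> * (\<Prod>i = 0..<m. M $$ (i, \<pi> i))) \<le> m * D div n"
    if \<pi>: "\<pi> permutes {0..<m}" for \<pi>
  proof (cases "\<exists>i<m. M $$ (i, \<pi> i) = 0")
    case True
    then have "(\<Prod>i = 0..<m. M $$ (i, \<pi> i)) = 0" by (intro prod_zero) auto
    then show ?thesis by (simp only: mult_zero_right Polynomial.degree_0 zero_le)
  next
    case False
    have "n * (\<Sum>i = 0..<m. Polynomial.degree (M $$ (i, \<pi> i))) + (\<Sum>i = 0..<m. wt i) =
        (\<Sum>i = 0..<m. n * Polynomial.degree (M $$ (i, \<pi> i)) + wt i)"
      by (simp add: sum.distrib sum_distrib_left)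
    also have "\<dots> \<le> (\<Sum>i = 0..<m. D + wt (\<pi> i))"
      using False permutes_in_image[OF \<pi>] by (intro sum_mono bound) auto
    also have "\<dots> = m * D + (\<Sum>i = 0..<m. wt i)"
      using sum.permute[OF \<pi>, of wt] by (simp add: sum.distrib o_def)
    finally have "(\<Sum>i = 0..<m. Polynomial.degree (M $$ (i, \<pi> i))) \<le> m * D div n"
      using n by (simp add: less_eq_div_iff_mult_less_eq mult.commute)
    moreover have "Polynomial.degree (\<Prod>i = 0..<m. M $$ (i, \<pi> i)) \<le>
        (\<Sum>i = 0..<m. Polynomial.degree (M $$ (i, \<pi> i)))"
      using degree_prod_sum_le[of "{0..<m}" "\<lambda>i. M $$ (i, \<pi> i)"] by (simp add: o_def)
    ultimately show ?thesis by (auto simp: sign_def)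
  qed
  then have "Polynomial.degree (det M) \<le> m * D div n"
    unfolding det_def'[OF M] by (intro degree_sum_le) (auto simp: finite_permutations)
  then show ?thesis using n by (simp add: less_eq_div_iff_mult_less_eq mult.commute)
qed

text \<open>The Kronecker product of the identity of size \<open>m\<close> with \<open>A\<close>,
  for \<open>A\<close> of size \<open>r\<close>. Index \<open>s\<close> stands for position
  \<open>s mod r\<close> in block \<open>s div r\<close>.\<close>

definition repeat_block :: "nat \<Rightarrow> nat \<Rightarrow> 'l::field mat \<Rightarrow> 'l mat" where
  "repeat_block r m A = mat (m * r) (m * r)
     (\<lambda>(s, s'). if s div r = s' div r then A $$ (s mod r, s' mod r) else 0)"

lemma det_repeat_block:
  assumes A: "A \<in> carrier_mat r r"
  shows "det (repeat_block r m A) = det A ^ m"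
proof (induction m)
  case 0
  then show ?case by (simp add: repeat_block_def)
next
  case (Suc m)
  have "repeat_block r (Suc m) A = four_block_mat (repeat_block r m A) (0\<^sub>m (m * r) r) (0\<^sub>m r (m * r)) A"
    (is "?L = ?R")
  proof (rule eq_matI)
    show "dim_row ?L = dim_row ?R" "dim_col ?L = dim_col ?R"
      using A by (auto simp: repeat_block_def)
    fix i l assume "i < dim_row ?R" "l < dim_col ?R"
    then have il: "i < m * r + r" "l < m * r + r" using A by (auto simp: repeat_block_def)
    have div_mod: "s div r = m \<and> s mod r = s - m * r" if "\<not> s < m * r" "s < m * r + r" for s
    proof -
      have "s = m * r + (s - m * r)" "s - m * r < r" using that by auto
      then show ?thesis
        by (metis add.commute add_cancel_left_left div_less div_mult_self3 mod_less mod_mult_self3 gr_implies_not0)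
    qed
    have div: "s div r < m" if "s < m * r" for s
      using that by (simp add: less_mult_imp_div_less)
    have L: "?L $$ (i, l) = (if i div r = l div r then A $$ (i mod r, l mod r) else 0)"
      using il by (simp add: repeat_block_def add.commute)
    have R: "?R $$ (i, l) =
        (if i < m * r then if l < m * r then if i div r = l div r then A $$ (i mod r, l mod r) else 0 else 0
         else if l < m * r then 0 else A $$ (i - m * r, l - m * r))"
      using il A by (simp add: repeat_block_def)
    show "?L $$ (i, l) = ?R $$ (i, l)"
    proof (cases "i < m * r"; cases "l < m * r")
      assume "i < m * r" "l < m * r"
      then show ?thesis unfolding L R by simp
    next
      assume "i < m * r" "\<not> l < m * r"
      then show ?thesis unfolding L R using div[of i] div_mod[of l] il by simp
    next
      assume "\<not> i < m * r" "l < m * r"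
      then show ?thesis unfolding L R using div[of l] div_mod[of i] il by simp
    next
      assume "\<not> i < m * r" "\<not> l < m * r"
      then show ?thesis unfolding L R using div_mod[of i] div_mod[of l] il by simp
    qed
  qed
  then have "det ?L = det (repeat_block r m A) * det A"
    using A by (simp only:) (rule det_four_block_mat_upper_right_zero, auto simp: repeat_block_def)
  then show ?case using Suc by simp
qed

text \<open>In the basis of matrix units, the left multiplication by \<open>Y\<close> on the matrices consists of
  \<open>r\<close> copies of \<open>Y\<close>, one for each column.\<close>

lemma det_left_multiplication:
  fixes Y :: "'l::field mat"
  assumes Y: "Y \<in> carrier_mat r r" and A: "\<And>q. q < r\<^sup>2 \<Longrightarrow> A q \<in> carrier_mat r r"
    and span: "\<And>B. B \<in> carrier_mat r r \<Longrightarrow>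
      \<exists>c. \<forall>i<r. \<forall>l<r. B $$ (i, l) = (\<Sum>q<r\<^sup>2. c q * A q $$ (i, l))"
    and M: "M \<in> carrier_mat (r\<^sup>2) (r\<^sup>2)"
    and mult: "\<And>q i l. q < r\<^sup>2 \<Longrightarrow> i < r \<Longrightarrow> l < r \<Longrightarrow>
      (Y * A q) $$ (i, l) = (\<Sum>p<r\<^sup>2. M $$ (p, q) * A p $$ (i, l))"
  shows "det M = det Y ^ r"
proof -
  \<comment> \<open>Column \<open>q\<close> of \<open>W\<close> lists the entries of
    \<open>A q\<close> column by column: index \<open>s\<close> is the entry in row
    \<open>s mod r\<close> and column \<open>s div r\<close>.\<close>
  define W where "W = mat (r\<^sup>2) (r\<^sup>2) (\<lambda>(s, q). A q $$ (s mod r, s div r))"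
  let ?D = "repeat_block r r Y"
  have W: "W \<in> carrier_mat (r\<^sup>2) (r\<^sup>2)" by (simp add: W_def)
  have D: "?D \<in> carrier_mat (r\<^sup>2) (r\<^sup>2)" by (simp add: repeat_block_def power2_eq_square)
  have idx: "s mod r < r" "s div r < r" if "s < r\<^sup>2" for s
  proof -
    have "r > 0" using that by (cases r) auto
    then show "s mod r < r" "s div r < r"
      using that by (simp_all add: power2_eq_square less_mult_imp_div_less)
  qed
  have "\<exists>c. \<forall>s'<r\<^sup>2. (\<Sum>q<r\<^sup>2. c q * W $$ (s', q)) = (if s' = s then 1 else 0)" if s: "s < r\<^sup>2" for s
  proof -
    \<comment> \<open>\<open>B\<close> is the matrix unit with its 1 at index \<open>s\<close>; its
      coordinates in the family \<open>A\<close> form column \<open>s\<close> of a right inverse of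
      \<open>W\<close>.\<close>
    define B :: "'l mat" where "B = mat r r (\<lambda>(i, l). if l * r + i = s then 1 else 0)"
    obtain c where c: "\<forall>i<r. \<forall>l<r. B $$ (i, l) = (\<Sum>q<r\<^sup>2. c q * A q $$ (i, l))"
      using span[of B] by (auto simp: B_def)
    have "(\<Sum>q<r\<^sup>2. c q * W $$ (s', q)) = (if s' = s then 1 else 0)" if "s' < r\<^sup>2" for s'
    proof -
      have "(\<Sum>q<r\<^sup>2. c q * W $$ (s', q)) = B $$ (s' mod r, s' div r)"
        using c idx[OF that] that by (simp add: W_def)
      then show ?thesis using idx[OF that] by (simp add: B_def)
    qed
    then show ?thesis by blast
  qed
  then obtain c where c: "\<And>s s'. s < r\<^sup>2 \<Longrightarrow> s' < r\<^sup>2 \<Longrightarrow>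
      (\<Sum>q<r\<^sup>2. c s q * W $$ (s', q)) = (if s' = s then 1 else 0)"
    by metis
  define V where "V = mat (r\<^sup>2) (r\<^sup>2) (\<lambda>(q, s). c s q)"
  have V: "V \<in> carrier_mat (r\<^sup>2) (r\<^sup>2)" by (simp add: V_def)
  have "W * V = 1\<^sub>m (r\<^sup>2)"
  proof (rule eq_matI)
    fix i l assume "i < dim_row (1\<^sub>m (r\<^sup>2))" "l < dim_col (1\<^sub>m (r\<^sup>2))"
    then have il: "i < r\<^sup>2" "l < r\<^sup>2" by auto
    then have "(W * V) $$ (i, l) = (\<Sum>q<r\<^sup>2. c l q * W $$ (i, q))"
      using W V by (simp add: scalar_prod_def V_def atLeast0LessThan mult.commute)
    then show "(W * V) $$ (i, l) = 1\<^sub>m (r\<^sup>2) $$ (i, l)" using il c[of l i] by simp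
  qed (use W V in auto)
  then have "det W * det V = 1" using det_mult[OF W V] by simp
  then have W0: "det W \<noteq> 0" by auto
  \<comment> \<open>Column \<open>q\<close> of either side lists the entries of
    \<open>Y * A q\<close>.\<close>
  have "?D * W = W * M"
  proof (rule eq_matI)
    fix s q assume "s < dim_row (W * M)" "q < dim_col (W * M)"
    then have sq: "s < r\<^sup>2" "q < r\<^sup>2" using W M by auto
    have "(?D * W) $$ (s, q) = (\<Sum>s'<r\<^sup>2. if s' div r = s div r
        then Y $$ (s mod r, s' mod r) * A q $$ (s' mod r, s div r) else 0)"
      using sq D W by (auto simp: scalar_prod_def repeat_block_def W_def atLeast0LessThan power2_eq_square
          intro!: sum.cong)
    also have "\<dots> = (\<Sum>s' | s' < r\<^sup>2 \<and> s' div r = s div r.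
        Y $$ (s mod r, s' mod r) * A q $$ (s' mod r, s div r))"
      by (subst sum.inter_filter[symmetric]) auto
    also have "\<dots> = (\<Sum>i<r. Y $$ (s mod r, i) * A q $$ (i, s div r))"
    proof (rule sum.reindex_bij_witness[of _ "\<lambda>i. (s div r) * r + i" "\<lambda>s'. s' mod r"])
      fix i assume "i \<in> {..<r}"
      then have i: "i < r" by simp
      have "(s div r) * r + i < (s div r + 1) * r" using i by simp
      also have "\<dots> \<le> r * r" using idx(2)[OF sq(1)] by (intro mult_right_mono) auto
      finally show "(s div r) * r + i \<in> {s'. s' < r\<^sup>2 \<and> s' div r = s div r}"
        using i by (simp add: power2_eq_square)
    next
    fix s' assume "s' \<in> {s'. s' < r\<^sup>2 \<and> s' div r = s div r}"
    then show "s div r * r + s' mod r = s'" by (metis (mono_tags) div_mult_mod_eq mem_Collect_eq)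
  qed (use idx in auto)
    also have "\<dots> = (Y * A q) $$ (s mod r, s div r)"
      using Y A[OF sq(2)] idx[OF sq(1)] by (simp add: scalar_prod_def atLeast0LessThan)
    also have "\<dots> = (W * M) $$ (s, q)"
      using mult[OF sq(2) idx[OF sq(1)]] sq W M
      by (simp add: scalar_prod_def W_def atLeast0LessThan mult.commute)
    finally show "(?D * W) $$ (s, q) = (W * M) $$ (s, q)" .
  qed (use D W M in auto)
  then have "det ?D * det W = det W * det M" using det_mult[OF D W] det_mult[OF W M] by metis
  then show ?thesis using W0 det_repeat_block[OF Y] by simp
qed

text \<open>F[x] is integrally closed in F(x). A denominator \<open>b\<close> of least degree stands
  in for a reduced fraction: an irreducible factor of \<open>b\<close> would divide
  \<open>a ^ k = p * b ^ k\<close>, hence \<open>a\<close>, and could be cancelled.\<close>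

lemma polynomial_if_power_polynomial:
  fixes x :: "'k::field poly fract"
  assumes "x ^ k = to_fract p" "k > 0"
  obtains q where "x = to_fract q"
proof -
  obtain a0 b0 where "x = Fract a0 b0" "b0 \<noteq> 0" by (cases x)
  then have "b0 \<noteq> 0 \<and> (\<exists>a. x = to_fract a / to_fract b0)" by (auto simp: Fract_conv_to_fract)
  then obtain b where b: "b \<noteq> 0" "\<exists>a. x = to_fract a / to_fract b"
    and min: "\<And>b'. b' \<noteq> 0 \<Longrightarrow> \<exists>a. x = to_fract a / to_fract b' \<Longrightarrow> Polynomial.degree b \<le> Polynomial.degree b'"
    using ex_has_least_nat[of "\<lambda>b. b \<noteq> 0 \<and> (\<exists>a. x = to_fract a / to_fract b)" b0 Polynomial.degree]
    by blast
  obtain a where a: "x = to_fract a / to_fract b" using b by blast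
  have to_fract_power: "to_fract (y ^ i) = to_fract y ^ i" for y :: "'k poly" and i
    by (induction i) simp_all
  have "Polynomial.degree b = 0"
  proof (rule ccontr)
    assume "Polynomial.degree b \<noteq> 0"
    then obtain \<pi> where \<pi>: "irreducible \<pi>" "\<pi> dvd b"
      using irreducible_factor_exists[of b] by auto
    have "to_fract (a ^ k) = to_fract (p * b ^ k)"
      using assms(1) b(1) by (simp add: a power_divide to_fract_power divide_simps)
    then have "a ^ k = p * b ^ k" by (simp only: to_fract_eq_iff)
    moreover have "\<pi> dvd b ^ k" using \<pi>(2) assms(2) by (metis dvd_power dvd_trans)
    ultimately have "\<pi> dvd a ^ k" by simp
    then have "\<pi> dvd a"
      using \<pi>(1) field_poly_irreducible_imp_prime prime_elem_dvd_power by blast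
    then obtain a' b' where ab: "a = \<pi> * a'" "b = \<pi> * b'" using \<pi>(2) by (auto elim!: dvdE)
    then have "b' \<noteq> 0" "\<pi> \<noteq> 0" using b by auto
    moreover from this have "x = to_fract a' / to_fract b'" by (simp add: a ab)
    moreover have "Polynomial.degree b' < Polynomial.degree b"
      using calculation irreducible_degree_pos[OF \<pi>(1)] by (simp add: ab degree_mult_eq)
    ultimately show False using min[of b'] by force
  qed
  then obtain c where c: "b = [:c:]" by (auto elim: degree_eq_zeroE)
  then have "a = b * Polynomial.smult (inverse c) a" using b by simp
  then have "x = to_fract (Polynomial.smult (inverse c) a)"
    using a b(1) by (metis to_fract_mult to_fract_eq_0_iff nonzero_mult_div_cancel_left)
  then show thesis by (rule that)
qed

lemma common_denominator:
  fixes c :: "'i \<Rightarrow> 'k::field poly fract"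
  assumes "finite I"
  shows "\<exists>q p. q \<noteq> 0 \<and> (\<forall>i\<in>I. to_fract q * c i = to_fract (p i))"
  using assms
proof (induction I rule: finite_induct)
  case empty
  then show ?case by (auto intro: exI[of _ 1])
next
  case (insert i I)
  obtain q p where qp: "q \<noteq> 0" "\<forall>k\<in>I. to_fract q * c k = to_fract (p k)" using insert.IH by blast
  obtain a b where ab: "c i = Fract a b" "b \<noteq> 0" by (cases "c i")
  show ?case
  proof (intro exI conjI ballI)
    show "q * b \<noteq> 0" using qp ab by simp
    fix k assume "k \<in> insert i I"
    then show "to_fract (q * b) * c k = to_fract ((if k = i then q * a else b * p k))"
      using qp ab insert.hyps by (auto simp: Fract_conv_to_fract)
  qed
qed

section \<open>The reduced norm of a skew polynomial\<close>

text \<open>Families take the place of sets, so that the indexing need not be known to be injective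
  in advance.\<close>

lemma (in vector_space) card_independent_family_le:
  assumes Q: "finite Q" and P: "finite P"
    and indep: "\<And>c q. (\<Sum>q\<in>Q. scale (c q) (w q)) = 0 \<Longrightarrow> q \<in> Q \<Longrightarrow> c q = 0"
    and span: "\<And>v. \<exists>c. v = (\<Sum>p\<in>P. scale (c p) (y p))"
  shows "card Q \<le> card P"
proof -
  have inj: "inj_on w Q"
  proof (rule inj_onI, rule ccontr)
    fix q q' assume q: "q \<in> Q" "q' \<in> Q" "w q = w q'" "q \<noteq> q'"
    \<comment> \<open>If \<open>w q = w q'\<close>, the coefficients 1 at \<open>q\<close> and -1 at
      \<open>q'\<close> give a nontrivial relation.\<close>
    have "(\<Sum>p\<in>Q. scale ((if p = q then 1 else 0) - (if p = q' then 1 else 0)) (w p)) =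
      (\<Sum>p\<in>Q. if p = q then w p else 0) - (\<Sum>p\<in>Q. if p = q' then w p else 0)"
      by (auto simp: sum_subtractf[symmetric] scale_left_diff_distrib intro!: sum.cong)
    also have "\<dots> = 0" using q Q by simp
    finally show False using indep[of "\<lambda>p. (if p = q then 1 else 0) - (if p = q' then 1 else 0)" q] q
      by simp
  qed
  have "independent (w ` Q)"
  proof (rule independent_if_scalars_zero)
    fix f x assume "(\<Sum>x\<in>w ` Q. scale (f x) x) = 0" "x \<in> w ` Q"
    then show "f x = 0" using indep[of "f \<circ> w"] by (auto simp: sum.reindex[OF inj])
  qed (use Q in auto)
  moreover have "w ` Q \<subseteq> span (y ` P)"
  proof
    fix v show "v \<in> span (y ` P)"
      using span[of v] by (auto intro!: span_sum span_scale intro: span_base)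
  qed
  ultimately have "card (w ` Q) \<le> card (y ` P)"
    using independent_span_bound[of "y ` P" "w ` Q"] P by auto
  then show ?thesis using card_image[OF inj] card_image_le[OF P, of y] by simp
qed

text \<open>The concrete setting, with F embedded by \<open>\<iota>\<close>, F(x) by
  \<open>\<kappa>\<close> and A[t;\<sigma>] by \<open>j\<close>. Its aim is the instance of
  \<open>skew_norm\<close> in which \<open>Z\<close> substitutes x and \<open>\<nu> g\<close> is the
  norm of \<open>j g\<close>.\<close>

locale central_quotient = skew_poly \<sigma> for \<sigma> :: "'a::division_ring \<Rightarrow> 'a" +
  fixes u :: 'a and n d :: nat and \<iota> :: "'k::field \<Rightarrow> 'a"
    and j :: "'a poly \<Rightarrow> 'b::ring_1" and \<kappa> :: "'k poly fract \<Rightarrow> 'b" and N :: "'b \<Rightarrow> 'k poly fract"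
  assumes n_pos: "n > 0" and d_pos: "d > 0"
    and \<iota>_hom: "Ring_Hom.ring_hom \<iota>" and \<iota>_central: "\<iota> c * z = z * \<iota> c" and \<iota>_fixed: "\<sigma> (\<iota> c) = \<iota> c"
    and u_nz: "u \<noteq> 0" and aut_pow_n: "(\<sigma> ^^ n) z = u * z * inverse u" and u_fixed: "\<sigma> u = u"
    and quot: "is_central_quotient_ring \<sigma> u n \<iota> j \<kappa>"
    and norm: "is_reduced_norm \<kappa> (d * n) N"
begin

section \<open>The central subring F[x]\<close>

sublocale \<iota>: Ring_Hom.ring_hom \<iota>
  by (rule \<iota>_hom)

sublocale \<kappa>: Ring_Hom.ring_hom \<kappa>
  using quot by (simp add: is_central_quotient_ring_def)

abbreviation Z :: "'k poly \<Rightarrow> 'a poly" where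
  "Z \<equiv> at_x \<sigma> u n \<iota>"

abbreviation r :: nat where
  "r \<equiv> d * n"

lemma r_pos: "r > 0"
  using n_pos d_pos by simp

lemma j_inj: "j f = j g \<longleftrightarrow> f = g" and j_add: "j (f + g) = j f + j g"
  and j_mult: "j (f \<star> g) = j f * j g" and \<kappa>_to_fract: "\<kappa> (to_fract p) = j (Z p)"
  and quotient_form: "\<exists>f g. g \<noteq> 0 \<and> b = j f * \<kappa> (inverse (to_fract g))"
  using quot by (auto simp: is_central_quotient_ring_def inj_def)

lemma j_0: "j 0 = 0"
  using j_add[of 0 0] by simp

lemma j_sum: "j (sum h S) = (\<Sum>x\<in>S. j (h x))"
  by (induction S rule: infinite_finite_induct) (simp_all add: j_0 j_add)

lemma \<iota>_eq_0_iff: "\<iota> c = 0 \<longleftrightarrow> c = 0"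
proof
  assume "\<iota> c = 0"
  then have "\<iota> (c * inverse c) = 0" by (simp add: \<iota>.hom_mult)
  then show "c = 0" by (cases "c = 0") auto
qed simp

lemma \<kappa>_inverse: "k \<noteq> 0 \<Longrightarrow> \<kappa> k * \<kappa> (inverse k) = 1" "k \<noteq> 0 \<Longrightarrow> \<kappa> (inverse k) * \<kappa> k = 1"
  by (simp_all flip: \<kappa>.hom_mult)

lemma \<kappa>_eq_0_iff: "\<kappa> k = 0 \<longleftrightarrow> k = 0"
  using \<kappa>_inverse[of k] by force

lemma inverse_u_fixed: "\<sigma> (inverse u) = inverse u"
proof -
  have "u * \<sigma> (inverse u) = 1" using aut_mult[of u "inverse u"] by (simp add: u_nz u_fixed aut_1)
  then show ?thesis by (metis inverse_unique)
qed

lemma inverse_u_pow_fixed: "\<sigma> (inverse u ^ k) = inverse u ^ k"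
  by (induction k) (simp_all add: aut_1 aut_mult inverse_u_fixed)

lemma skew_power_x:
  "skew_power \<sigma> (Polynomial.monom (inverse u) n) k = Polynomial.monom (inverse u ^ k) (n * k)"
  by (induction k) (simp_all add: skew_power_def skew_prod_Cons monom_mult_monom
      aut_pow_fixed[OF inverse_u_pow_fixed] monom_0 one_pCons)

lemma at_x_eq:
  "Z p = (\<Sum>k\<le>Polynomial.degree p. Polynomial.monom (\<iota> (Polynomial.coeff p k) * inverse u ^ k) (n * k))"
  by (simp add: at_x_def skew_power_x monom_mult_monom flip: monom_0)

lemma coeff_at_x:
  "Polynomial.coeff (Z p) l =
     (if n dvd l then \<iota> (Polynomial.coeff p (l div n)) * inverse u ^ (l div n) else 0)"
proof (cases "n dvd l")
  case True
  then obtain k where k: "l = n * k" by auto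
  have "Polynomial.coeff (Z p) l = (\<Sum>k'\<le>Polynomial.degree p.
      if k' = k then \<iota> (Polynomial.coeff p k) * inverse u ^ k else 0)"
    using n_pos by (auto simp: at_x_eq Polynomial.coeff_sum k intro!: sum.cong)
  then show ?thesis using n_pos by (simp add: k coeff_eq_0)
qed (auto simp: at_x_eq Polynomial.coeff_sum intro!: sum.neutral)

lemma at_x_add: "Z (p + q) = Z p + Z q"
  by (simp add: poly_eq_iff coeff_at_x \<iota>.hom_add distrib_right)

lemma at_x_1: "Z 1 = [:1:]"
  using n_pos by (auto simp: poly_eq_iff coeff_at_x coeff_pCons split: nat.splits elim!: dvdE)

text \<open>Read off in the quotient ring, where \<open>Z p\<close> becomes
  \<open>\<kappa> (to_fract p)\<close> and \<open>\<kappa>\<close> is a homomorphism.\<close>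

lemma at_x_mult: "Z (p * q) = Z p \<star> Z q"
  by (metis j_inj j_mult \<kappa>_to_fract \<kappa>.hom_mult to_fract_mult)

lemma at_x_0: "Z 0 = 0"
  by (simp add: poly_eq_iff coeff_at_x)

lemma at_x_eq_0_iff: "Z p = 0 \<longleftrightarrow> p = 0"
  by (metis at_x_0 j_0 \<kappa>_to_fract \<kappa>_eq_0_iff to_fract_eq_0_iff)

lemma degree_at_x: "Polynomial.degree (Z p) = n * Polynomial.degree p"
proof (rule antisym)
  show "Polynomial.degree (Z p) \<le> n * Polynomial.degree p"
    using n_pos by (intro degree_le) (auto simp: coeff_at_x coeff_eq_0 elim!: dvdE)
  show "n * Polynomial.degree p \<le> Polynomial.degree (Z p)"
  proof (cases "p = 0")
    case False
    then show ?thesis using n_pos u_nz by (intro Polynomial.le_degree) (simp add: coeff_at_x \<iota>_eq_0_iff)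
  qed simp
qed

text \<open>Moving a coefficient past \<open>t^n\<close> applies \<sigma>^n, which is conjugation by
  \<open>u\<close> and is undone by \<open>inverse u\<close>. Moving \<open>inverse u\<close> past
  powers of \<open>t\<close> changes nothing, since \<sigma> fixes it.\<close>

lemma x_central:
  "Polynomial.monom (inverse u) n \<star> g = g \<star> Polynomial.monom (inverse u) n"
  using u_nz
  by (simp add: poly_eq_iff coeff_monom_mult coeff_mult_monom aut_pow_n
      aut_pow_fixed[OF inverse_u_fixed] flip: mult.assoc)

lemma \<iota>_const_central: "[:\<iota> c:] \<star> g = g \<star> [:\<iota> c:]"
  unfolding monom_0[symmetric]
  by (simp add: poly_eq_iff coeff_monom_mult coeff_mult_monom aut_pow_fixed[OF \<iota>_fixed] \<iota>_central)

lemma at_x_central: "Z p \<star> g = g \<star> Z p"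
proof -
  have pow: "skew_power \<sigma> (Polynomial.monom (inverse u) n) k \<star> g =
      g \<star> skew_power \<sigma> (Polynomial.monom (inverse u) n) k" for k
    by (induction k) (auto simp: skew_power_def skew_prod_Cons mult_assoc, metis mult_assoc x_central)
  have "[:\<iota> c:] \<star> skew_power \<sigma> (Polynomial.monom (inverse u) n) k \<star> g =
      g \<star> ([:\<iota> c:] \<star> skew_power \<sigma> (Polynomial.monom (inverse u) n) k)" for c k
    by (metis mult_assoc pow \<iota>_const_central)
  then show ?thesis by (simp add: at_x_def mult_sum_left mult_sum_right)
qed

text \<open>Commuting with \<open>j f\<close> passes from F[x] to inverses, and every element of the
  quotient ring is a fraction.\<close>

lemma \<kappa>_central: "\<kappa> k * b = b * \<kappa> k"
proof -
  have poly: "\<kappa> (to_fract p) * j f = j f * \<kappa> (to_fract p)" for p f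
    by (simp add: \<kappa>_to_fract at_x_central flip: j_mult)
  have inv: "\<kappa> (inverse (to_fract q)) * j f = j f * \<kappa> (inverse (to_fract q))" if "q \<noteq> 0" for q f
  proof -
    let ?q = "\<kappa> (to_fract q)" and ?i = "\<kappa> (inverse (to_fract q))"
    have i: "?q * ?i = 1" "?i * ?q = 1" using that by (simp_all add: \<kappa>_inverse)
    have "?i * j f = ?i * j f * (?q * ?i)" by (simp add: i)
    also have "\<dots> = ?i * (?q * j f) * ?i" unfolding poly by (simp add: mult.assoc)
    also have "\<dots> = j f * ?i" by (simp add: i flip: mult.assoc)
    finally show ?thesis .
  qed
  obtain p q where k: "k = to_fract p * inverse (to_fract q)" "q \<noteq> 0"
    by (cases k) (simp add: Fract_conv_to_fract divide_inverse)
  obtain f g where b: "b = j f * \<kappa> (inverse (to_fract g))" using quotient_form by blast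
  have "\<kappa> k * b = \<kappa> (to_fract p) * (\<kappa> (inverse (to_fract q)) * j f) * \<kappa> (inverse (to_fract g))"
    by (simp add: b k \<kappa>.hom_mult mult.assoc)
  also have "\<dots> = j f * (\<kappa> k * \<kappa> (inverse (to_fract g)))"
    unfolding inv[OF k(2)] by (simp add: k \<kappa>.hom_mult poly flip: mult.assoc)
  also have "\<dots> = b * \<kappa> k"
    unfolding b by (simp add: mult.assoc mult.commute[of k] flip: \<kappa>.hom_mult)
  finally show ?thesis .
qed

text \<open>Centrality puts \<open>Z p\<close> on the right of the monomial. The power of
  \<open>inverse u\<close> then stands to the right of \<open>a\<close> and can be factored out of
  sums over \<open>a\<close>.\<close>

lemma coeff_at_x_mult_monom:
  "Polynomial.coeff (Z p \<star> Polynomial.monom a i) l =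
     (if i \<le> l \<and> n dvd l - i
      then \<iota> (Polynomial.coeff p ((l - i) div n)) * a * inverse u ^ ((l - i) div n) else 0)"
proof -
  have "(\<sigma> ^^ i) (\<iota> c * inverse u ^ k) = \<iota> c * inverse u ^ k" for c k
    by (rule aut_pow_fixed) (simp add: aut_mult \<iota>_fixed inverse_u_pow_fixed)
  then show ?thesis
    by (simp add: at_x_central coeff_monom_mult coeff_at_x \<iota>_central mult.assoc)
qed

text \<open>Since \<open>i < n\<close>, the power \<open>t^l\<close> arises only from the terms with
  \<open>i = l mod n\<close> and the coefficient of x^(l div n).\<close>

lemma coeff_monom_combination:
  "Polynomial.coeff (\<Sum>a\<in>S. \<Sum>i<n. Z (P a i) \<star> Polynomial.monom a i) l =
     (\<Sum>a\<in>S. \<iota> (Polynomial.coeff (P a (l mod n)) (l div n)) * a) * inverse u ^ (l div n)"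
proof -
  have "i \<le> l \<and> n dvd l - i \<longleftrightarrow> i = l mod n" if "i < n" for i
    using that by (metis mod_less mod_less_eq_dividend mod_eq_dvd_iff_nat mod_mod_trivial dvd_minus_mod)
  then have "(\<Sum>i<n. Polynomial.coeff (Z (P a i) \<star> Polynomial.monom a i) l) =
      (\<Sum>i<n. if i = l mod n
        then \<iota> (Polynomial.coeff (P a (l mod n)) (l div n)) * a * inverse u ^ (l div n) else 0)" for a
    by (intro sum.cong) (auto simp: coeff_at_x_mult_monom minus_mod_eq_mult_div n_pos)
  then show ?thesis using n_pos by (simp add: Polynomial.coeff_sum sum_distrib_right)
qed

section \<open>A basis of A[t;\<sigma>] over F[x]\<close>

lemma vector_space_A: "vector_space (\<lambda>c a. \<iota> c * a)"
  by unfold_locales (simp_all add: distrib_left distrib_right \<iota>.hom_add \<iota>.hom_mult mult.assoc)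

lemma vector_space_B: "vector_space (\<lambda>k b. \<kappa> k * b)"
  by unfold_locales (simp_all add: distrib_left distrib_right \<kappa>.hom_add \<kappa>.hom_mult mult.assoc)

lemma monoms_independent:
  assumes S: "finite S" and indep: "\<And>c a. (\<Sum>a\<in>S. \<iota> (c a) * a) = 0 \<Longrightarrow> a \<in> S \<Longrightarrow> c a = 0"
    and zero: "(\<Sum>(a, i)\<in>S \<times> {..<n}. Z (P a i) \<star> Polynomial.monom a i) = 0"
    and ai: "a \<in> S" "i < n"
  shows "P a i = 0"
proof (rule poly_eqI)
  fix y
  \<comment> \<open>The coefficient of \<open>t^(n * y + i)\<close> isolates the \<open>y\<close>-th
    coefficients of the \<open>P a i\<close> for this \<open>i\<close>.\<close>
  have "(\<Sum>a\<in>S. \<iota> (Polynomial.coeff (P a i) y) * a) * inverse u ^ y = 0"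
    using coeff_monom_combination[of P S "n * y + i"] zero ai n_pos
    by (simp add: sum.cartesian_product)
  then have "(\<Sum>a\<in>S. \<iota> (Polynomial.coeff (P a i) y) * a) = 0" using u_nz by simp
  then show "Polynomial.coeff (P a i) y = Polynomial.coeff 0 y" using indep ai by simp
qed

text \<open>A common denominator turns a relation over F(x) into one over F[x], which descends along
  the injective \<open>j\<close>.\<close>

lemma independent_over_fractions:
  assumes Q: "finite Q" and indep: "\<And>P q. (\<Sum>q\<in>Q. Z (P q) \<star> w q) = 0 \<Longrightarrow> q \<in> Q \<Longrightarrow> P q = 0"
    and zero: "(\<Sum>q\<in>Q. \<kappa> (c q) * j (w q)) = 0" and q: "q \<in> Q"
  shows "c q = 0"
proof -
  obtain D P where D: "D \<noteq> 0" and P: "\<forall>q\<in>Q. to_fract D * c q = to_fract (P q)"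
    using common_denominator[OF Q, of c] by blast
  have "j (\<Sum>q\<in>Q. Z (P q) \<star> w q) = (\<Sum>q\<in>Q. \<kappa> (to_fract (P q)) * j (w q))"
    by (simp add: j_sum j_mult \<kappa>_to_fract)
  also have "\<dots> = \<kappa> (to_fract D) * (\<Sum>q\<in>Q. \<kappa> (c q) * j (w q))"
    unfolding sum_distrib_left
    by (intro sum.cong refl) (use P in \<open>simp add: \<kappa>.hom_mult mult.assoc flip: bspec[OF P]\<close>)
  finally have "(\<Sum>q\<in>Q. Z (P q) \<star> w q) = 0" using zero j_inj[of _ 0] by (simp add: j_0)
  then have "to_fract D * c q = 0" using indep q P by simp
  then show ?thesis using D by simp
qed

lemma spanning_over_fractions:
  assumes span: "\<And>f. \<exists>P. f = (\<Sum>q\<in>Q. Z (P q) \<star> w q)"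
  shows "\<exists>c. b = (\<Sum>q\<in>Q. \<kappa> (c q) * j (w q))"
proof -
  obtain f g where b: "b = j f * \<kappa> (inverse (to_fract g))" using quotient_form by blast
  obtain P where P: "f = (\<Sum>q\<in>Q. Z (P q) \<star> w q)" using span by blast
  have "b = (\<Sum>q\<in>Q. \<kappa> (to_fract (P q)) * j (w q)) * \<kappa> (inverse (to_fract g))"
    by (simp add: b P j_sum j_mult \<kappa>_to_fract)
  also have "\<dots> = (\<Sum>q\<in>Q. \<kappa> (inverse (to_fract g) * to_fract (P q)) * j (w q))"
    unfolding \<kappa>_central[symmetric] by (simp add: sum_distrib_left \<kappa>.hom_mult mult.assoc)
  finally show ?thesis by (rule exI[of _ "\<lambda>q. inverse (to_fract g) * to_fract (P q)"])
qed

lemma splitting_basis: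
  assumes "is_splitting \<kappa> r \<phi>"
  obtains \<beta> where "\<And>c i. (\<Sum>i<r\<^sup>2. \<kappa> (c i) * \<beta> i) = 0 \<Longrightarrow> i < r\<^sup>2 \<Longrightarrow> c i = 0"
    "\<And>b. \<exists>c. b = (\<Sum>i<r\<^sup>2. \<kappa> (c i) * \<beta> i)"
    "\<And>M. M \<in> carrier_mat r r \<Longrightarrow>
      \<exists>c. \<forall>i<r. \<forall>l<r. M $$ (i, l) = (\<Sum>q<r\<^sup>2. c q * \<phi> (\<beta> q) $$ (i, l))"
proof -
  obtain \<beta> where \<beta>: "is_basis (range \<kappa>) UNIV (r\<^sup>2) \<beta>"
    and M: "\<And>M. M \<in> carrier_mat r r \<Longrightarrow>
      \<exists>c. \<forall>i<r. \<forall>l<r. M $$ (i, l) = (\<Sum>q<r\<^sup>2. c q * \<phi> (\<beta> q) $$ (i, l))"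
    using assms unfolding is_splitting_def by blast
  have ex1: "\<exists>!c. (\<forall>i<r\<^sup>2. c i \<in> range \<kappa>) \<and> (\<forall>i\<ge>r\<^sup>2. c i = 0) \<and> b = (\<Sum>i<r\<^sup>2. c i * \<beta> i)" for b
    using \<beta> by (simp add: is_basis_def)
  have "c i = 0" if zero: "(\<Sum>i<r\<^sup>2. \<kappa> (c i) * \<beta> i) = 0" and i: "i < r\<^sup>2" for c i
  proof -
    \<comment> \<open>Uniqueness in \<open>is_basis\<close> concerns coefficient families that
      vanish from \<open>r^2\<close> on, so \<open>c\<close> is cut off there.\<close>
    let ?c = "\<lambda>i. if i < r\<^sup>2 then \<kappa> (c i) else 0"
    have "(\<Sum>i<r\<^sup>2. ?c i * \<beta> i) = (\<Sum>i<r\<^sup>2. \<kappa> (c i) * \<beta> i)" by (intro sum.cong) auto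
    then have sum_0: "0 = (\<Sum>i<r\<^sup>2. ?c i * \<beta> i)" using zero by simp
    have range: "0 \<in> range \<kappa>" by (metis \<kappa>.hom_zero rangeI)
    obtain c0 where c0: "\<And>c. (\<forall>i<r\<^sup>2. c i \<in> range \<kappa>) \<Longrightarrow> (\<forall>i\<ge>r\<^sup>2. c i = 0) \<Longrightarrow>
        0 = (\<Sum>i<r\<^sup>2. c i * \<beta> i) \<Longrightarrow> c = c0"
      using ex1[of 0] by (elim ex1E) blast
    have "?c = c0" using sum_0 by (intro c0) auto
    moreover have "(\<lambda>i. 0) = c0" using range by (intro c0) auto
    ultimately have "?c = (\<lambda>i. 0)" by simp
    then have "\<kappa> (c i) = 0" using i by meson
    then show ?thesis by (simp add: \<kappa>_eq_0_iff)
  qed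
  moreover have "\<exists>c. b = (\<Sum>i<r\<^sup>2. \<kappa> (c i) * \<beta> i)" for b
  proof -
    obtain c where c: "\<forall>i<r\<^sup>2. c i \<in> range \<kappa>" "b = (\<Sum>i<r\<^sup>2. c i * \<beta> i)" using ex1[of b] by blast
    then have "\<forall>i<r\<^sup>2. \<exists>k. c i = \<kappa> k" by blast
    then obtain k where "\<forall>i<r\<^sup>2. c i = \<kappa> (k i)" by metis
    then show ?thesis using c(2) by (intro exI[of _ k]) simp
  qed
  ultimately show thesis using M that by blast
qed

text \<open>\<open>rep z\<close> gives coordinates of \<open>z\<close> in \<open>S\<close>, and
  exponents are split as \<open>n * y + i\<close>. The degree bound holds for each coefficient
  polynomial separately; it supplies the weights for \<open>degree_det_le\<close>.\<close>

lemma monoms_span: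
  assumes rep: "\<And>z. (\<Sum>a\<in>S. \<iota> (rep z a) * a) = z" "\<And>a. rep 0 a = 0"
  obtains P where "f = (\<Sum>(a, i)\<in>S \<times> {..<n}. Z (P a i) \<star> Polynomial.monom a i)"
    "\<And>a i. P a i \<noteq> 0 \<Longrightarrow> n * Polynomial.degree (P a i) + i \<le> Polynomial.degree f"
proof
  \<comment> \<open>The factor \<open>u ^ y\<close> compensates the \<open>inverse u ^ y\<close> in
    the \<open>y\<close>-th power of x.\<close>
  define P where "P a i =
    (\<Sum>y\<le>Polynomial.degree f. Polynomial.monom (rep (Polynomial.coeff f (n * y + i) * u ^ y) a) y)" for a i
  have coeff_P: "Polynomial.coeff (P a i) y = rep (Polynomial.coeff f (n * y + i) * u ^ y) a" for a i y
  proof (cases "y \<le> Polynomial.degree f")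
    case False
    then have "Polynomial.degree f < n * y + i"
      using n_pos by (metis less_le_trans mult_le_mono1 nat_mult_1 not_le Suc_leI One_nat_def trans_less_add1)
    with False show ?thesis by (simp add: P_def Polynomial.coeff_sum coeff_eq_0 rep(2))
  qed (simp add: P_def Polynomial.coeff_sum)
  show "f = (\<Sum>(a, i)\<in>S \<times> {..<n}. Z (P a i) \<star> Polynomial.monom a i)"
    using u_nz n_pos
    by (intro poly_eqI) (simp add: sum.cartesian_product[symmetric] coeff_monom_combination coeff_P rep(1)
        mult.assoc power_inverse)
  show "n * Polynomial.degree (P a i) + i \<le> Polynomial.degree f" if "P a i \<noteq> 0" for a i
  proof (rule Polynomial.le_degree, rule notI)
    assume "Polynomial.coeff f (n * Polynomial.degree (P a i) + i) = 0"
    then have "Polynomial.lead_coeff (P a i) = 0" unfolding coeff_P by (simp add: rep(2))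
    then show False using that by simp
  qed
qed

text \<open>The basis consists of the a t^i with a in an F-basis \<open>S\<close> of A and i < n,
  and \<open>wt\<close> is the exponent i. Independence over F(x) and the \<open>r^2\<close>
  elements of a splitting basis bound the finite parts of \<open>S\<close>, so \<open>S\<close> is
  finite. As the a t^i also span the quotient ring, their number is exactly
  \<open>r^2\<close>.\<close>

lemma monomial_basis:
  obtains w wt where
    "\<And>f. \<exists>P. f = (\<Sum>q<r\<^sup>2. Z (P q) \<star> w q) \<and>
      (\<forall>q<r\<^sup>2. P q \<noteq> 0 \<longrightarrow> n * Polynomial.degree (P q) + wt q \<le> Polynomial.degree f)"
    "\<And>P q. (\<Sum>q<r\<^sup>2. Z (P q) \<star> w q) = 0 \<Longrightarrow> q < r\<^sup>2 \<Longrightarrow> P q = 0"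
    "\<And>q. Polynomial.degree (w q) \<le> wt q"
proof -
  obtain \<phi> where "is_splitting \<kappa> r \<phi>" using norm by (auto simp: is_reduced_norm_def)
  then obtain \<beta> where
    \<beta>: "\<And>c i. (\<Sum>i<r\<^sup>2. \<kappa> (c i) * \<beta> i) = 0 \<Longrightarrow> i < r\<^sup>2 \<Longrightarrow> c i = 0"
      "\<And>b. \<exists>c. b = (\<Sum>i<r\<^sup>2. \<kappa> (c i) * \<beta> i)"
    by (rule splitting_basis) blast
  interpret A: vector_space "\<lambda>c a. \<iota> c * a" by (rule vector_space_A)
  interpret B: vector_space "\<lambda>k b. \<kappa> k * b" by (rule vector_space_B)
  obtain S where S: "A.independent S" "UNIV \<subseteq> A.span S"
    using A.maximal_independent_subset[of UNIV] by blast
  let ?m = "\<lambda>q. Polynomial.monom (fst q) (snd q)"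
  have indep: "P q = 0" if T: "T \<subseteq> S" "finite T"
    and zero: "(\<Sum>q\<in>T \<times> {..<n}. Z (P q) \<star> ?m q) = 0" and q: "q \<in> T \<times> {..<n}" for T P q
  proof -
    have "P (fst q, snd q) = 0"
    proof (rule monoms_independent[of T "\<lambda>a i. P (a, i)"])
      show "c a = 0" if "(\<Sum>a\<in>T. \<iota> (c a) * a) = 0" "a \<in> T" for c a
        using A.independentD[OF S(1) T(2,1) that] .
    qed (use T zero q in \<open>auto simp: case_prod_unfold\<close>)
    then show ?thesis by simp
  qed
  have indep_\<kappa>: "c q = 0" if T: "T \<subseteq> S" "finite T"
    and zero: "(\<Sum>q\<in>T \<times> {..<n}. \<kappa> (c q) * j (?m q)) = 0" and q: "q \<in> T \<times> {..<n}" for T c q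
    by (rule independent_over_fractions[OF _ _ zero q]) (use T indep in auto)
  have bound: "card T * n \<le> r\<^sup>2" if "T \<subseteq> S" "finite T" for T
  proof -
    have "card (T \<times> {..<n}) \<le> card {..<r\<^sup>2}"
      using that indep_\<kappa>[OF that] \<beta>(2)
      by (intro B.card_independent_family_le[where w = "\<lambda>q. j (?m q)" and y = \<beta>]) auto
    then show ?thesis by (simp add: card_cartesian_product)
  qed
  have "card T \<le> r\<^sup>2" if "T \<subseteq> S" "finite T" for T
    using bound[OF that] n_pos by (metis le_trans mult_le_mono2 nat_mult_1_right Suc_leI One_nat_def)
  then have fin: "finite S" using finite_if_finite_subsets_card_bdd[of S "r\<^sup>2"] by blast
  define Q where "Q = S \<times> {..<n}"
  have Q: "finite Q" using fin by (simp add: Q_def)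
  have span: "\<exists>P. f = (\<Sum>q\<in>Q. Z (P q) \<star> ?m q) \<and>
      (\<forall>q\<in>Q. P q \<noteq> 0 \<longrightarrow> n * Polynomial.degree (P q) + snd q \<le> Polynomial.degree f)" for f
  proof -
    have rep: "(\<Sum>a\<in>S. \<iota> (A.representation S z a) * a) = z" for z
      using S fin by (intro A.sum_representation_eq) auto
    obtain P where "f = (\<Sum>(a, i)\<in>S \<times> {..<n}. Z (P a i) \<star> Polynomial.monom a i)"
      "\<And>a i. P a i \<noteq> 0 \<Longrightarrow> n * Polynomial.degree (P a i) + i \<le> Polynomial.degree f"
      using monoms_span[OF rep, of f] by (auto simp: A.representation_zero)
    then show ?thesis
      by (intro exI[of _ "\<lambda>q. P (fst q) (snd q)"]) (auto simp: Q_def case_prod_unfold)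
  qed
  have "card {..<r\<^sup>2} \<le> card Q"
  proof (rule B.card_independent_family_le[where w = \<beta> and y = "\<lambda>q. j (?m q)"])
    show "\<exists>c. b = (\<Sum>q\<in>Q. \<kappa> (c q) * j (?m q))" for b
      using span by (intro spanning_over_fractions) blast
  qed (use Q \<beta>(1) in auto)
  then have "card Q = r\<^sup>2" using bound[OF _ fin] by (simp add: Q_def card_cartesian_product)
  then obtain h where h: "bij_betw h {..<r\<^sup>2} Q"
    using ex_bij_betw_nat_finite[OF Q] by (auto simp: atLeast0LessThan)
  have reindex: "(\<Sum>q<r\<^sup>2. F (h q)) = (\<Sum>q\<in>Q. F q)" for F :: "'a \<times> nat \<Rightarrow> 'a poly"
    by (rule sum.reindex_bij_betw[OF h])
  have h_Q: "h q \<in> Q" if "q < r\<^sup>2" for q using h that by (auto simp: bij_betw_def)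
  show thesis
  proof (rule that[of "\<lambda>q. ?m (h q)" "\<lambda>q. snd (h q)"])
    show "\<exists>P. f = (\<Sum>q<r\<^sup>2. Z (P q) \<star> ?m (h q)) \<and>
      (\<forall>q<r\<^sup>2. P q \<noteq> 0 \<longrightarrow> n * Polynomial.degree (P q) + snd (h q) \<le> Polynomial.degree f)" for f
    proof -
      obtain P where P: "f = (\<Sum>q\<in>Q. Z (P q) \<star> ?m q)"
        "\<forall>q\<in>Q. P q \<noteq> 0 \<longrightarrow> n * Polynomial.degree (P q) + snd q \<le> Polynomial.degree f"
        using span by blast
      show ?thesis
        using P h_Q reindex[of "\<lambda>q. Z (P q) \<star> ?m q"] by (intro exI[of _ "\<lambda>q. P (h q)"]) simp
    qed
    show "P q = 0" if "(\<Sum>q<r\<^sup>2. Z (P q) \<star> ?m (h q)) = 0" "q < r\<^sup>2" for P q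
    proof -
      let ?P = "\<lambda>x. P (inv_into {..<r\<^sup>2} h x)"
      have P: "?P (h q) = P q" if "q < r\<^sup>2" for q
        using h that by (simp add: bij_betw_def inv_into_f_f)
      then have "(\<Sum>q\<in>Q. Z (?P q) \<star> ?m q) = 0"
        using that(1) reindex[of "\<lambda>x. Z (?P x) \<star> ?m x"] by simp
      then have "?P (h q) = 0"
        using h_Q[OF that(2)] fin unfolding Q_def by (intro indep[of S ?P]) auto
      then show ?thesis using P that(2) by simp
    qed
    show "Polynomial.degree (?m (h q)) \<le> snd (h q)" for q by (rule degree_monom_le)
  qed
qed

section \<open>The determinant of left multiplication\<close>

lemma at_x_sum: "Z (sum p S) = (\<Sum>x\<in>S. Z (p x))"
  by (induction S rule: infinite_finite_induct) (simp_all add: at_x_0 at_x_add)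

lemma splitting_combination:
  assumes "is_splitting \<kappa> r \<phi>" and il: "i < r" "l < r"
  shows "\<phi> (\<Sum>p\<in>P. \<kappa> (c p) * b p) $$ (i, l) = (\<Sum>p\<in>P. to_ac (c p) * \<phi> (b p) $$ (i, l))"
proof -
  have carrier: "\<phi> b \<in> carrier_mat r r" and add: "\<phi> (b + c) = \<phi> b + \<phi> c"
    and mult: "\<phi> (b * c) = \<phi> b * \<phi> c" and scalar: "\<phi> (\<kappa> k) = to_ac k \<cdot>\<^sub>m 1\<^sub>m r" for b c k
    using assms(1) by (auto simp: is_splitting_def)
  have zero: "\<phi> 0 $$ (i, l) = 0" using scalar[of 0] il by simp
  have smult: "\<phi> (\<kappa> k * b) $$ (i, l) = to_ac k * \<phi> b $$ (i, l)" for k b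
  proof -
    have "\<phi> (\<kappa> k * b) = to_ac k \<cdot>\<^sub>m (1\<^sub>m r * \<phi> b)"
      unfolding mult scalar using carrier[of b] by (intro mult_smult_assoc_mat) auto
    then show ?thesis using carrier[of b] il by simp
  qed
  have "\<phi> (b + c) $$ (i, l) = \<phi> b $$ (i, l) + \<phi> c $$ (i, l)" for b c
    unfolding add using carrier[of c] il by simp
  then show ?thesis
    by (induction P rule: infinite_finite_induct) (simp_all add: zero smult)
qed

text \<open>With the matrix \<open>M\<close> of the left multiplication by \<open>g\<close> on the free \<open>F[x]\<close>-module
  \<open>A[t;\<sigma>]\<close>, the \<open>r\<close>-th power of the norm is \<open>det M\<close>, and the adjugate of \<open>M\<close> turns \<open>det M\<close> into a
  multiple of \<open>g\<close>.\<close>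

lemma norm_power:
  assumes g: "g \<noteq> 0"
  obtains D y where "N (j g) ^ r = to_fract D" "D \<noteq> 0"
    "n * Polynomial.degree D \<le> r\<^sup>2 * Polynomial.degree g" "g \<star> y = Z D"
proof -
  obtain \<phi> where \<phi>: "is_splitting \<kappa> r \<phi>" and N: "\<And>b. to_ac (N b) = det (\<phi> b)"
    using norm by (auto simp: is_reduced_norm_def)
  have carrier: "\<phi> b \<in> carrier_mat r r" and mult: "\<phi> (b * c) = \<phi> b * \<phi> c" for b c
    using \<phi> by (auto simp: is_splitting_def)
  obtain \<beta> where
    \<beta>: "\<And>B. B \<in> carrier_mat r r \<Longrightarrow>
      \<exists>c. \<forall>i<r. \<forall>l<r. B $$ (i, l) = (\<Sum>q<r\<^sup>2. c q * \<phi> (\<beta> q) $$ (i, l))"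
    by (rule splitting_basis[OF \<phi>]) blast
  obtain w wt where
    span: "\<And>f. \<exists>P. f = (\<Sum>q<r\<^sup>2. Z (P q) \<star> w q) \<and>
      (\<forall>q<r\<^sup>2. P q \<noteq> 0 \<longrightarrow> n * Polynomial.degree (P q) + wt q \<le> Polynomial.degree f)"
    and indep: "\<And>P q. (\<Sum>q<r\<^sup>2. Z (P q) \<star> w q) = 0 \<Longrightarrow> q < r\<^sup>2 \<Longrightarrow> P q = 0"
    and wt: "\<And>q. Polynomial.degree (w q) \<le> wt q"
    by (rule monomial_basis) blast
  have "\<forall>q. \<exists>P. g \<star> w q = (\<Sum>p<r\<^sup>2. Z (P p) \<star> w p) \<and>
      (\<forall>p<r\<^sup>2. P p \<noteq> 0 \<longrightarrow> n * Polynomial.degree (P p) + wt p \<le> Polynomial.degree (g \<star> w q))"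
    using span by blast
  then obtain C where C: "\<And>q. g \<star> w q = (\<Sum>p<r\<^sup>2. Z (C q p) \<star> w p)"
    and deg_C: "\<And>q p. p < r\<^sup>2 \<Longrightarrow> C q p \<noteq> 0 \<Longrightarrow>
      n * Polynomial.degree (C q p) + wt p \<le> Polynomial.degree (g \<star> w q)"
    by metis
  define M where "M = mat (r\<^sup>2) (r\<^sup>2) (\<lambda>(p, q). C q p)"
  have M: "M \<in> carrier_mat (r\<^sup>2) (r\<^sup>2)" by (simp add: M_def)
  \<comment> \<open>Column \<open>q\<close> of \<open>M\<close> holds the coordinates of
    \<open>g \<star> w q\<close>; since the coefficients are central, left multiplication by
    \<open>g\<close> is linear.\<close>
  have apply_M: "g \<star> (\<Sum>q<r\<^sup>2. Z (v $ q) \<star> w q) = (\<Sum>p<r\<^sup>2. Z ((M *\<^sub>v v) $ p) \<star> w p)"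
    if v: "v \<in> carrier_vec (r\<^sup>2)" for v
  proof -
    have "g \<star> (\<Sum>q<r\<^sup>2. Z (v $ q) \<star> w q) = (\<Sum>q<r\<^sup>2. Z (v $ q) \<star> (g \<star> w q))"
      unfolding mult_sum_right by (intro sum.cong refl) (metis mult_assoc at_x_central)
    also have "\<dots> = (\<Sum>q<r\<^sup>2. \<Sum>p<r\<^sup>2. Z (C q p * v $ q) \<star> w p)"
      unfolding C mult_sum_right by (simp add: at_x_mult mult_assoc mult.commute[of _ "v $ _"])
    also have "\<dots> = (\<Sum>p<r\<^sup>2. \<Sum>q<r\<^sup>2. Z (C q p * v $ q) \<star> w p)" by (rule sum.swap)
    also have "\<dots> = (\<Sum>p<r\<^sup>2. Z (\<Sum>q<r\<^sup>2. C q p * v $ q) \<star> w p)"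
      by (simp add: at_x_sum mult_sum_left)
    also have "\<dots> = (\<Sum>p<r\<^sup>2. Z ((M *\<^sub>v v) $ p) \<star> w p)"
      using v by (intro sum.cong refl) (simp add: M_def scalar_prod_def atLeast0LessThan)
    finally show ?thesis .
  qed
  interpret h: Ring_Hom.comm_ring_hom "\<lambda>p. to_ac (to_fract p) :: 'k poly fract alg_closure"
    by unfold_locales simp_all
  have "det (map_mat (\<lambda>p. to_ac (to_fract p)) M) = det (\<phi> (j g)) ^ r"
  proof (rule det_left_multiplication[where A = "\<lambda>q. \<phi> (j (w q))"])
    fix B :: "'k poly fract alg_closure mat" assume "B \<in> carrier_mat r r"
    then obtain c where c: "\<forall>i<r. \<forall>l<r. B $$ (i, l) = (\<Sum>s<r\<^sup>2. c s * \<phi> (\<beta> s) $$ (i, l))"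
      using \<beta> by blast
    \<comment> \<open>Each \<open>\<beta> s\<close> is an F(x)-combination of the
      \<open>w q\<close>, so the images of the \<open>w q\<close> span the matrices as well.\<close>
    have "\<forall>s. \<exists>e. \<beta> s = (\<Sum>q<r\<^sup>2. \<kappa> (e q) * j (w q))"
      using span by (intro allI spanning_over_fractions) blast
    then obtain e where e: "\<And>s. \<beta> s = (\<Sum>q<r\<^sup>2. \<kappa> (e s q) * j (w q))" by metis
    have B: "B $$ (i, l) = (\<Sum>q<r\<^sup>2. (\<Sum>s<r\<^sup>2. c s * to_ac (e s q)) * \<phi> (j (w q)) $$ (i, l))"
      if "i < r" "l < r" for i l
    proof -
      have "B $$ (i, l) = (\<Sum>s<r\<^sup>2. \<Sum>q<r\<^sup>2. c s * to_ac (e s q) * \<phi> (j (w q)) $$ (i, l))"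
        using c that by (subst (asm) e) (simp add: splitting_combination[OF \<phi>] sum_distrib_left mult.assoc)
      then show ?thesis by (subst (asm) sum.swap) (simp add: sum_distrib_right)
    qed
    show "\<exists>c. \<forall>i<r. \<forall>l<r. B $$ (i, l) = (\<Sum>q<r\<^sup>2. c q * \<phi> (j (w q)) $$ (i, l))"
      by (rule exI[of _ "\<lambda>q. \<Sum>s<r\<^sup>2. c s * to_ac (e s q)"]) (simp add: B)
  next
    fix q i l assume q: "q < r\<^sup>2" and il: "i < r" "l < r"
    have "j g * j (w q) = (\<Sum>p<r\<^sup>2. \<kappa> (to_fract (C q p)) * j (w p))"
      unfolding j_mult[symmetric] C by (simp add: j_sum j_mult \<kappa>_to_fract)
    then have "(\<phi> (j g) * \<phi> (j (w q))) $$ (i, l) =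
        (\<Sum>p<r\<^sup>2. to_ac (to_fract (C q p)) * \<phi> (j (w p)) $$ (i, l))"
      using splitting_combination[OF \<phi> il] by (simp flip: mult)
    then show "(\<phi> (j g) * \<phi> (j (w q))) $$ (i, l) =
        (\<Sum>p<r\<^sup>2. map_mat (\<lambda>p. to_ac (to_fract p)) M $$ (p, q) * \<phi> (j (w p)) $$ (i, l))"
      using q by (simp add: M_def)
  qed (use carrier M in auto)
  then have "to_ac (N (j g) ^ r) = to_ac (to_fract (det M))" by (simp add: h.hom_det N)
  then have power: "N (j g) ^ r = to_fract (det M)" by (simp only: to_ac_eq_iff)
  \<comment> \<open>A nonzero kernel vector would hold the coordinates of a nonzero polynomial
    annihilated by \<open>g\<close>, but there are no zero divisors.\<close>
  have "det M \<noteq> 0"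
  proof
    assume "det M = 0"
    then obtain v where v: "v \<in> carrier_vec (r\<^sup>2)" "v \<noteq> 0\<^sub>v (r\<^sup>2)" "M *\<^sub>v v = 0\<^sub>v (r\<^sup>2)"
      using det_0_iff_vec_prod_zero[OF M] by blast
    have "g \<star> (\<Sum>q<r\<^sup>2. Z (v $ q) \<star> w q) = 0" unfolding apply_M[OF v(1)] v(3) by (simp add: at_x_0)
    then have "(\<Sum>q<r\<^sup>2. Z (v $ q) \<star> w q) = 0" using g by (simp add: mult_eq_0_iff)
    then have "v = 0\<^sub>v (r\<^sup>2)" using indep[of "\<lambda>q. v $ q"] v(1) by (intro eq_vecI) auto
    then show False using v(2) by simp
  qed
  moreover have "n * Polynomial.degree (det M) \<le> r\<^sup>2 * Polynomial.degree g"
  proof (rule degree_det_le[OF M _ n_pos, where wt = wt])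
    fix p q assume pq: "p < r\<^sup>2" "q < r\<^sup>2" "M $$ (p, q) \<noteq> 0"
    then have "n * Polynomial.degree (M $$ (p, q)) + wt p \<le> Polynomial.degree (g \<star> w q)"
      using deg_C by (simp add: M_def)
    also have "\<dots> \<le> Polynomial.degree g + wt q" using degree_mult_le[of g "w q"] wt[of q] by simp
    finally show "n * Polynomial.degree (M $$ (p, q)) + wt p \<le> Polynomial.degree g + wt q" .
  qed
  moreover have "\<exists>y. g \<star> y = Z (det M)"
  proof -
    \<comment> \<open>\<open>e\<close> holds the coordinates of 1. As \<open>M\<close> times its
      adjugate is \<open>det M\<close> times the identity, \<open>v\<close> holds the coordinates of
      some \<open>y\<close> with \<open>g \<star> y = Z (det M)\<close>.\<close>
    obtain e where e: "[:1:] = (\<Sum>q<r\<^sup>2. Z (e q) \<star> w q)" using span by blast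
    define v where "v = adj_mat M *\<^sub>v vec (r\<^sup>2) e"
    have v: "v \<in> carrier_vec (r\<^sup>2)" using adj_mat(1)[OF M] by (simp add: v_def)
    have "M *\<^sub>v v = (M * adj_mat M) *\<^sub>v vec (r\<^sup>2) e"
      unfolding v_def using M adj_mat(1)[OF M] by (simp add: assoc_mult_mat_vec[of _ "r\<^sup>2" "r\<^sup>2" _ "r\<^sup>2"])
    also have "\<dots> = det M \<cdot>\<^sub>v vec (r\<^sup>2) e"
      unfolding adj_mat(2)[OF M] by (intro eq_vecI) (auto simp: smult_scalar_prod_distrib[of _ "r\<^sup>2"])
    finally have Mv: "M *\<^sub>v v = det M \<cdot>\<^sub>v vec (r\<^sup>2) e" .
    have "g \<star> (\<Sum>q<r\<^sup>2. Z (v $ q) \<star> w q) = (\<Sum>p<r\<^sup>2. Z (det M * e p) \<star> w p)"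
      unfolding apply_M[OF v] Mv by simp
    also have "\<dots> = Z (det M) \<star> [:1:]" unfolding e by (simp add: at_x_mult mult_sum_right mult_assoc)
    finally show ?thesis by auto
  qed
  ultimately show thesis using that power by blast
qed

section \<open>The norm as a polynomial and its degree\<close>

lemma N_mult: "N (b * c) = N b * N c"
  and N_\<kappa>: "N (\<kappa> k) = k ^ r"
proof -
  obtain \<phi> where \<phi>: "is_splitting \<kappa> r \<phi>" and N: "\<And>b. to_ac (N b) = det (\<phi> b)"
    using norm by (auto simp: is_reduced_norm_def)
  have "\<phi> b \<in> carrier_mat r r" for b using \<phi> by (simp add: is_splitting_def)
  then have "det (\<phi> b * \<phi> c) = det (\<phi> b) * det (\<phi> c)" by (metis det_mult)
  then have "to_ac (N (b * c)) = to_ac (N b * N c)" using \<phi> by (simp add: N is_splitting_def)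
  then show "N (b * c) = N b * N c" by (simp only: to_ac_eq_iff)
  have "to_ac (N (\<kappa> k)) = to_ac (k ^ r)" using \<phi> by (simp add: N is_splitting_def)
  then show "N (\<kappa> k) = k ^ r" by (simp only: to_ac_eq_iff)
qed

lemma norm_polynomial: "\<exists>p. N (j g) = to_fract p"
proof (cases "g = 0")
  case True
  have "N (j g) = to_fract 0" using N_\<kappa>[of 0] r_pos by (simp add: True j_0 power_0_left)
  then show ?thesis by blast
next
  case False
  then obtain D where "N (j g) ^ r = to_fract D" by (rule norm_power)
  then show ?thesis using r_pos polynomial_if_power_polynomial by metis
qed

text \<open>Well defined by \<open>norm_polynomial\<close> and the injectivity of
  \<open>to_fract\<close>.\<close>

definition \<nu> :: "'a poly \<Rightarrow> 'k poly" where
  "\<nu> g = (THE p. N (j g) = to_fract p)"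

lemma N_eq_iff: "N (j g) = to_fract p \<longleftrightarrow> \<nu> g = p"
proof -
  obtain p' where "N (j g) = to_fract p'" using norm_polynomial by blast
  then show ?thesis by (auto simp: \<nu>_def)
qed

lemma N_eq: "N (j g) = to_fract (\<nu> g)"
  by (simp add: N_eq_iff)

lemma norm_mult: "\<nu> (f \<star> g) = \<nu> f * \<nu> g"
proof -
  have "N (j (f \<star> g)) = to_fract (\<nu> f * \<nu> g)" by (simp add: j_mult N_mult N_eq)
  then show ?thesis by (simp only: N_eq_iff)
qed

lemma norm_at_x: "\<nu> (Z p) = p ^ r"
proof -
  have "to_fract (p ^ k) = to_fract p ^ k" for k by (induction k) simp_all
  then have "N (j (Z p)) = to_fract (p ^ r)" by (simp add: N_\<kappa> flip: \<kappa>_to_fract)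
  then show ?thesis by (simp only: N_eq_iff)
qed

lemma norm_power_multiple:
  assumes g: "g \<noteq> 0"
  obtains y where "\<nu> g \<noteq> 0" "n * Polynomial.degree (\<nu> g) \<le> r * Polynomial.degree g" "g \<star> y = Z (\<nu> g ^ r)"
proof -
  obtain D y where D: "N (j g) ^ r = to_fract D" "D \<noteq> 0"
    "n * Polynomial.degree D \<le> r\<^sup>2 * Polynomial.degree g" "g \<star> y = Z D"
    using norm_power[OF g] by blast
  have "to_fract (\<nu> g ^ k) = to_fract (\<nu> g) ^ k" for k by (induction k) simp_all
  then have "to_fract D = to_fract (\<nu> g ^ r)" using D(1) by (simp only: N_eq)
  then have D_eq: "D = \<nu> g ^ r" by (simp only: to_fract_eq_iff)
  then have nz: "\<nu> g \<noteq> 0" using D(2) r_pos by (auto simp: power_0_left)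
  have "r * (n * Polynomial.degree (\<nu> g)) \<le> r * (r * Polynomial.degree g)"
    using D(3) nz unfolding D_eq by (simp add: degree_power_eq power2_eq_square mult.left_commute mult.assoc)
  then have "n * Polynomial.degree (\<nu> g) \<le> r * Polynomial.degree g" using r_pos by (simp only: mult_le_cancel1)
  then show thesis using that nz D(4) D_eq by blast
qed

lemma norm_eq_0_iff: "\<nu> g = 0 \<longleftrightarrow> g = 0"
  using norm_power_multiple[of g] norm_at_x[of 0] r_pos by (auto simp: at_x_0 power_0_left)

lemma degree_norm_le: "Polynomial.degree (\<nu> g) \<le> d * Polynomial.degree g"
proof (cases "g = 0")
  case True
  then show ?thesis by (simp add: norm_eq_0_iff[THEN iffD2])
next
  case False
  then have "n * Polynomial.degree (\<nu> g) \<le> n * (d * Polynomial.degree g)"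
    by (rule norm_power_multiple) (simp add: mult_ac)
  then show ?thesis using n_pos by (simp only: mult_le_cancel1)
qed

text \<open>Both degree bounds for \<open>g \<star> y = Z p\<close> are sharp because \<open>\<nu> (Z p) = p ^ r\<close> has the largest
  possible degree.\<close>

lemma degree_norm: "Polynomial.degree (\<nu> g) = d * Polynomial.degree g"
proof (cases "g = 0")
  case True
  then show ?thesis by (simp add: norm_eq_0_iff[THEN iffD2])
next
  case False
  then obtain y where g: "\<nu> g \<noteq> 0" and y: "g \<star> y = Z (\<nu> g ^ r)" by (rule norm_power_multiple)
  then have y0: "y \<noteq> 0" by (auto simp: at_x_eq_0_iff eq_commute[of 0])
  have "Polynomial.degree (\<nu> g) + Polynomial.degree (\<nu> y) = Polynomial.degree (\<nu> (Z (\<nu> g ^ r)))"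
    unfolding y[symmetric] norm_mult using g y0 by (simp add: degree_mult_eq norm_eq_0_iff)
  also have "\<dots> = d * (n * Polynomial.degree (\<nu> g ^ r))"
    unfolding norm_at_x using g by (simp add: degree_power_eq)
  also have "n * Polynomial.degree (\<nu> g ^ r) = Polynomial.degree g + Polynomial.degree y"
    unfolding degree_at_x[symmetric] y[symmetric] using False y0 by (rule degree_mult)
  finally show ?thesis
    using degree_norm_le[of g] degree_norm_le[of y] by (simp add: distrib_left)
qed

text \<open>\<open>norm_power_multiple\<close> gives a right multiple \<open>g y\<close> that is
  central. Then \<open>g y g = g (g y)\<close>, and cancelling \<open>g\<close> gives
  \<open>y g = g y\<close>.\<close>

lemma central_left_multiple:
  assumes g: "g \<noteq> 0"
  shows "\<exists>p. p \<noteq> 0 \<and> right_divides \<sigma> g (Z p)"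
proof -
  obtain y where p: "\<nu> g \<noteq> 0" and y: "g \<star> y = Z (\<nu> g ^ r)" using g by (rule norm_power_multiple)
  have "g \<star> (y \<star> g) = g \<star> Z (\<nu> g ^ r)" by (metis mult_assoc y at_x_central)
  then have "Z (\<nu> g ^ r) = y \<star> g" using g by (metis mult_left_cancel)
  then show ?thesis using p by (intro exI[of _ "\<nu> g ^ r"]) (auto simp: right_divides_def)
qed

sublocale skew_norm \<sigma> Z \<nu> d r
  by unfold_locales
    (fact at_x_add at_x_mult at_x_1 at_x_central norm_mult norm_at_x norm_eq_0_iff degree_norm d_pos
      central_left_multiple)+

text \<open>The constants are nonzero because their product is 1. Conversely, the norms of the
  factors multiply to \<open>\<nu> f\<close>, which is exactly \<open>prod_list ks\<close>, so the
  product of the constants has to be 1.\<close>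

lemma norms_match_iff:
  assumes fs: "f = skew_prod \<sigma> fs" and ks: "\<nu> f = prod_list ks" and f: "f \<noteq> 0"
  shows "norms_match (\<lambda>g. N (j g)) fs ks \<longleftrightarrow> list_all2 (\<lambda>g. proportional (\<nu> g)) fs ks"
proof
  assume "norms_match (\<lambda>g. N (j g)) fs ks"
  then obtain c where c: "length fs = length ks" "(\<Prod>i<length ks. c i) = 1"
    "\<And>i. i < length ks \<Longrightarrow> \<nu> (fs ! i) = Polynomial.smult (c i) (ks ! i)"
    by (auto simp: norms_match_def N_eq_iff)
  then have "c i \<noteq> 0" if "i < length ks" for i
    using that prod_zero[of "{..<length ks}" c] by fastforce
  then show "list_all2 (\<lambda>g. proportional (\<nu> g)) fs ks"
    using c by (auto simp: list_all2_conv_all_nth proportional_def)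
next
  assume "list_all2 (\<lambda>g. proportional (\<nu> g)) fs ks"
  then have len: "length fs = length ks"
    and "\<forall>i<length ks. \<exists>c. \<nu> (fs ! i) = Polynomial.smult c (ks ! i)"
    by (auto simp: list_all2_conv_all_nth proportional_def)
  then obtain c where c: "\<And>i. i < length ks \<Longrightarrow> \<nu> (fs ! i) = Polynomial.smult (c i) (ks ! i)"
    by metis
  have "prod_list ks = prod_list (map \<nu> fs)" by (simp add: ks[symmetric] fs \<nu>_skew_prod)
  also have "\<dots> = (\<Prod>i<length ks. Polynomial.smult (c i) (ks ! i))"
    using len c by (simp add: prod.list_conv_set_nth[of "map \<nu> fs"] atLeast0LessThan)
  also have "\<dots> = Polynomial.smult (\<Prod>i<length ks. c i) (prod_list ks)"
    by (simp add: prod_smult prod.list_conv_set_nth[of ks] atLeast0LessThan)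
  finally have "Polynomial.smult ((\<Prod>i<length ks. c i) - 1) (prod_list ks) = 0"
    by (simp add: smult_diff_left)
  moreover have "prod_list ks \<noteq> 0" using f by (simp add: ks[symmetric] norm_eq_0_iff)
  ultimately have "(\<Prod>i<length ks. c i) = 1" by simp
  then show "norms_match (\<lambda>g. N (j g)) fs ks"
    using len c by (auto simp: norms_match_def N_eq_iff)
qed

text \<open>Minimality is stated for monic polynomials and for degrees in t. Dividing
  \<open>p\<close> by its leading coefficient preserves right divisibility, and
  \<open>degree_at_x\<close> converts degrees in t to \<open>n\<close> times degrees in x.\<close>

lemma full_if_min_central_left_multiple:
  assumes f: "f \<noteq> 0" and min: "is_min_central_left_multiple \<sigma> u n \<iota> f h ph"
    and deg: "Polynomial.degree ph = d * Polynomial.degree f"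
  shows "full f"
proof (rule full_if_degree_minimal[OF f])
  fix p assume p: "p \<noteq> 0" "right_divides \<sigma> f (Z p)"
  let ?c = "inverse (Polynomial.lead_coeff p)"
  have "right_divides \<sigma> f (Z ([:?c:] * p))"
    unfolding Z_mult using p(2) by (rule right_divides_mult_left)
  moreover have "Polynomial.lead_coeff ([:?c:] * p) = 1" using p(1) by simp
  moreover have "Z ([:?c:] * p) \<in> skew_center \<sigma>" by (simp add: skew_center_def at_x_central)
  ultimately have "Polynomial.degree h \<le> Polynomial.degree (Z ([:?c:] * p))"
    using min unfolding is_min_central_left_multiple_def by blast
  moreover have "h = Z ph" using min by (simp add: is_min_central_left_multiple_def)
  ultimately show "d * Polynomial.degree f \<le> Polynomial.degree p"
    using p(1) n_pos by (simp add: degree_at_x deg)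
qed

lemma full_factorization_norms_match_ex1:
  assumes f: "full f" "Polynomial.lead_coeff f = 1"
    and hs: "N (j f) = to_fract (prod_list hs)" "\<forall>p\<in>set hs. irreducible p"
  shows "\<exists>!fs. fs \<in> factorizations \<sigma> f \<and> norms_match (\<lambda>g. N (j g)) fs hs"
proof -
  have "\<nu> f = prod_list hs" "f \<noteq> 0" using hs f by (auto simp: N_eq_iff)
  then have "fs \<in> factorizations \<sigma> f \<and> norms_match (\<lambda>g. N (j g)) fs hs \<longleftrightarrow>
      fs \<in> factorizations \<sigma> f \<and> list_all2 (\<lambda>g. proportional (\<nu> g)) fs hs" for fs
    using norms_match_iff by (auto simp: factorizations_def)
  then show ?thesis
    using full_ordered_factorization_ex1[OF f hs(2)] \<open>\<nu> f = prod_list hs\<close> by (simp add: proportional_refl)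
qed

end

text \<open>For \<open>d = 0\<close>, the element 1 would be an empty sum.\<close>

lemma cyclic_algebra_pos:
  assumes "cyclic_algebra E C \<gamma> d a e"
  shows "d > 0"
proof (rule ccontr)
  assume "\<not> d > 0"
  moreover have "\<exists>c. (1 :: 'a) = (\<Sum>i<d. c i * e ^ i)"
    using assms unfolding cyclic_algebra_def is_basis_def by blast
  ultimately show False by simp
qed

text \<open>\<open>c\<close> commutes with E, which is commutative, and with \<open>e\<close>, since
  \<gamma> fixes C; every element is a sum of products of these.\<close>

lemma cyclic_algebra_central:
  assumes A: "cyclic_algebra E C \<gamma> d a e" and c: "c \<in> C"
  shows "c * z = z * c"
proof -
  have E: "is_subfield E" "C \<subseteq> E" "\<gamma> c = c" "\<forall>z\<in>E. e * z = \<gamma> z * e"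
    using A c by (auto simp: cyclic_algebra_def cyclic_galois_def galois_group_def)
  then have "e * c = c * e" using c by auto
  then have pow: "c * e ^ i = e ^ i * c" for i
    by (induction i) (simp_all, metis mult.assoc)
  have comm: "c * y = y * c" if "y \<in> E" for y
    using E(1,2) c that unfolding is_subfield_def by blast
  have "\<exists>b. (\<forall>i<d. b i \<in> E) \<and> z = (\<Sum>i<d. b i * e ^ i)"
    using A unfolding cyclic_algebra_def is_basis_def by blast
  then obtain b where b: "\<forall>i<d. b i \<in> E" "z = (\<Sum>i<d. b i * e ^ i)" by blast
  have "c * (b i * e ^ i) = b i * e ^ i * c" if "i < d" for i
    using b(1) that comm pow by (metis mult.assoc)
  then show ?thesis by (simp add: b(2) sum_distrib_left sum_distrib_right)
qed

text \<open>In (ii), distinct factors are pairwise nonassociated irreducible ones, and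
  \<open>ks\<close> runs through their orderings.\<close>

theorem corollary15:
  fixes E C :: "'a::division_ring set" and \<gamma> \<sigma> :: "'a \<Rightarrow> 'a" and a e u :: 'a
    and d n m :: nat
    and \<iota> :: "'k::field \<Rightarrow> 'a"
    and j :: "'a poly \<Rightarrow> 'b::ring_1" and \<kappa> :: "'k poly fract \<Rightarrow> 'b" and N :: "'b \<Rightarrow> 'k poly fract"
    and f h :: "'a poly" and ph :: "'k poly"
  assumes "cyclic_algebra E C \<gamma> d a e"
    and "ring_aut_on UNIV \<sigma>"
    and "has_order_mod_inner \<sigma> n"
    and "has_order_on C \<sigma> n"
    and "Ring_Hom.ring_hom \<iota>" and "range \<iota> = C \<inter> {b. \<sigma> b = b}"
    and "u \<noteq> 0" and "\<And>z. (\<sigma> ^^ n) z = u * z * inverse u" and "\<sigma> u = u"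
    and "ring_aut_on E \<sigma>" and "u \<in> E" and "\<And>z. z \<in> E \<Longrightarrow> \<gamma> (\<sigma> z) = \<sigma> (\<gamma> z)"
    and "is_central_quotient_ring \<sigma> u n \<iota> j \<kappa>"
    and "is_reduced_norm \<kappa> (d * n) N"
    and "Polynomial.lead_coeff f = 1" and "Polynomial.degree f = m"
    and "is_gcrd \<sigma> f (Polynomial.monom 1 1) [:1:]"
    and "is_min_central_left_multiple \<sigma> u n \<iota> f h ph"
    and "Polynomial.degree ph = d * m"
  shows
    "(\<forall>hs. N (j f) = to_fract (prod_list hs) \<and> (\<forall>p\<in>set hs. irreducible p) \<longrightarrow>
        (\<exists>fs \<in> factorizations \<sigma> f. norms_match (\<lambda>g. N (j g)) fs hs \<and>
           (\<forall>g\<in>set fs. \<forall>p. N (j g) = to_fract p \<longrightarrow>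
              real (Polynomial.degree g) = real (Polynomial.degree p) / real d)))
     \<and>
     (\<forall>hs. N (j f) = to_fract (prod_list hs) \<and> (\<forall>p\<in>set hs. irreducible p) \<and>
        (\<forall>i<length hs. \<forall>k<length hs. i \<noteq> k \<longrightarrow> \<not> hs ! i dvd hs ! k) \<longrightarrow>
        card (factorizations \<sigma> f) = fact (length hs) \<and>
        (\<forall>ks. mset ks = mset hs \<longrightarrow>
           (\<exists>!fs. fs \<in> factorizations \<sigma> f \<and> norms_match (\<lambda>g. N (j g)) fs ks)))"
proof -
  have \<iota>: "\<iota> c \<in> C" "\<sigma> (\<iota> c) = \<iota> c" for c using assms(6) by auto
  interpret central_quotient \<sigma> u n d \<iota> j \<kappa> N
  proof (intro central_quotient.intro skew_poly.intro central_quotient_axioms.intro)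
    show "n > 0" using assms(3) by (simp add: has_order_mod_inner_def)
    show "d > 0" by (rule cyclic_algebra_pos[OF assms(1)])
    show "\<iota> c * z = z * \<iota> c" for c z by (rule cyclic_algebra_central[OF assms(1) \<iota>(1)])
  qed (fact assms \<iota>(2))+
  have f0: "f \<noteq> 0" using assms(15) by auto
  have f: "full f"
    by (rule full_if_min_central_left_multiple[OF f0 assms(18)]) (simp add: assms(16,19))
  show ?thesis
  proof (intro conjI allI impI; elim conjE)
    fix hs assume hs: "N (j f) = to_fract (prod_list hs)" "\<forall>p\<in>set hs. irreducible p"
    obtain fs where fs: "fs \<in> factorizations \<sigma> f" "norms_match (\<lambda>g. N (j g)) fs hs"
      using full_factorization_norms_match_ex1[OF f assms(15) hs] by blast
    moreover have "real (Polynomial.degree g) = real (Polynomial.degree p) / real d"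
      if "N (j g) = to_fract p" for g p
      using that d_pos by (auto simp: N_eq_iff degree_norm)
    ultimately show "\<exists>fs \<in> factorizations \<sigma> f. norms_match (\<lambda>g. N (j g)) fs hs \<and>
           (\<forall>g\<in>set fs. \<forall>p. N (j g) = to_fract p \<longrightarrow>
              real (Polynomial.degree g) = real (Polynomial.degree p) / real d)"
      by blast
  next
    fix hs assume hs: "N (j f) = to_fract (prod_list hs)" "\<forall>p\<in>set hs. irreducible p"
      and distinct: "\<forall>i<length hs. \<forall>k<length hs. i \<noteq> k \<longrightarrow> \<not> hs ! i dvd hs ! k"
    have "\<nu> f = prod_list hs" using hs(1) by (simp add: N_eq_iff)
    then show "card (factorizations \<sigma> f) = fact (length hs)"
      using card_full_factorizations[OF f assms(15) hs(2) _ distinct] by (simp add: proportional_refl)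
    fix ks assume ks: "mset ks = mset hs"
    then have "prod_list ks = prod_list hs" by (metis prod_mset_prod_list)
    moreover have "set ks = set hs" using ks by (metis set_mset_mset)
    ultimately show "\<exists>!fs. fs \<in> factorizations \<sigma> f \<and> norms_match (\<lambda>g. N (j g)) fs ks"
      using hs by (intro full_factorization_norms_match_ex1[OF f assms(15)]) simp_all
  qed
qed

end
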